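(* Let $\mathcal{M}$ be a semi-Markovian causal model with causal graph $\mathcal{G}$, observed variables $\mathcal{V} = \{\mathbf{x}, t, y\}$ (features $\mathbf{x}$, treatment $t$, outcome $y$) and unobserved variables $\mathcal{U}$. Suppose that (1) the outcome $y$ is a descendant of the treatment $t$; (2) there is an unobserved confounder between the outcome $y$ and the treatment $t$; (3) $\mathbf{b}$, the set of all children of the treatment $t$, is observed and known. If there exists a set $\mathbf{z} \subseteq \mathcal{V} \setminus \{t, \mathbf{b}, y\}$ such that $\mathbf{b}$ and $y$ are d-separated by $\{t\} \cup \mathbf{z}$ in $\mathcal{G}$, then the causal effect of $t$ on $y$ is identifiable from observational data without the knowledge of the underlying causal graph $\mathcal{G}$.
   Context: Semi-Markovian causal model (SMCM). Let $\mathcal{W} = \mathcal{V} \cup \mathcal{U}$, with $\mathcal{V}$ the set of observed variables and $\mathcal{U}$ the set of unobserved variables. An SMCM is specified as follows: - $\mathcal{G}$ is a directed acyclic graph over the vertex set $\mathcal{W}$ such that no element of $\mathcal{U}$ has parents; - for $v \in \mathcal{V}$, $\pi^{(o)}(v) \subseteq \mathcal{V}$ and $\pi^{(u)}(v) \subseteq \mathcal{U}$ denote the sets of parents of $v$ in $\mathcal{V}$ and in $\mathcal{U}$; - $\mathbb{P}(\mathbf{u})$ is the joint distribution of the unobserved variables; - the observational distribution is $\mathbb{P}(\mathbf{v}) = \mathbb{E}_{\mathbf{u}}\big[\prod_{v \in \mathcal{V}} \mathbb{P}(v \mid \pi^{(o)}(v), \pi^{(u)}(v))\big]$; - the interventional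 distribution when the variables $\mathbf{r} \subset \mathcal{V}$ are set to the fixed value $r$ is $\mathbb{P}(\mathbf{v} \mid do(\mathbf{r} = r)) = \mathbf{1}_{\mathbf{r} = r} \cdot \mathbb{E}_{\mathbf{u}}\big[\prod_{v \in \mathcal{V} \setminus \mathbf{r}} \mathbb{P}(v \mid \pi^{(o)}(v), \pi^{(u)}(v))\big]$; - for $v_1, v_2 \in \mathcal{V}$, if $\pi^{(u)}(v_1) \cap \pi^{(u)}(v_2) \neq \emptyset$, then $v_1$ and $v_2$ have a bi-directed edge $v_1 \leftrightarrow v_2$ in $\mathcal{G}$. Hypothesis (2) says that $t \leftrightarrow y$. Causal effect. The causal effect of $t$ (when forced to a value $\tau$) on $y$ is $\mathbb{P}(y \mid do(t=\tau)) = \sum_{\mathbf{v} \setminus \{y\}} \mathbb{P}(\mathbf{v} \setminus \{y\}, y \mid do(t=\tau))$. Identifiability. Given an observational distribution $\mathbb{P}(\mathbf{v})$ and a causal graph $\mathcal{G}$, the causal effect $\mathbb{P}(y \mid do(t=\tau))$ is identifiable if it is identical for every SMCM with (a) the same graph $\mathcal{G}$ and (b) the same observational distribution $\mathbb{P}(\mathbf{v})$. The words "without the knowledge of $\mathcal{G}$" are explained in the source as follows: the hypothesis is a conditional independence statement that can be tested solely from observational data, without requiring the graph $\mathcal{G}$, and it guarantees identifiability. The source adds that the theorem does not provide a formula for the effect, and that different causal graphs satisfying the hypothesis lead to different formulae. d-separation. A path is an ordered sequence of distinct nodes, each joined to the next by an edge. A path between $w_1$ and $w_2$ is blocked by a set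 $\mathbf{w} \subset \mathcal{W} \setminus \{w_1, w_2\}$ if some node $w$ on it satisfies either (a) $w$ is not a collider on the path and $w \in \mathbf{w}$, or (b) $w$ is a collider on the path and neither $w$ nor any of its descendants is in $\mathbf{w}$. Nodes $w_1$ and $w_2$ are d-separated by $\mathbf{w}$ in $\mathcal{G}$ if $\mathbf{w}$ blocks every path between them; sets are d-separated if every pair of elements, one from each set, is. Standing assumption (causal faithfulness): any conditional independence of $w_1$ and $w_2$ given $\mathbf{w}$ implies that $w_1$ and $w_2$ are d-separated by $\mathbf{w}$ in $\mathcal{G}$.
   Formalization: The observational distribution is assumed strictly positive and the unobserved variables mutually independent; without these the effect need not be identifiable (e.g. if t=τ has probability 0, or if separate unobserved parents of t and of a child of t are correlated). *)

theory Defs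
  imports "HOL-Probability.Probability"
begin

section \<open>Causal graphs\<close>

record 'w causal_graph =
  observed :: "'w set"
  unobserved :: "'w set"
  edges :: "('w \<times> 'w) set"

definition nodes :: "'w causal_graph \<Rightarrow> 'w set" where
  "nodes G = observed G \<union> unobserved G"

text \<open>The codomain of the edge relation is the observed part: unobserved variables have no parents.\<close>

definition is_causal_graph :: "'w causal_graph \<Rightarrow> bool" where
  "is_causal_graph G \<longleftrightarrow>
     finite (observed G) \<and> finite (unobserved G) \<and>
     observed G \<inter> unobserved G = {} \<and>
     edges G \<subseteq> nodes G \<times> observed G \<and>
     acyclic (edges G)"

definition parents_obs :: "'w causal_graph \<Rightarrow> 'w \<Rightarrow> 'w set" where
  "parents_obs G v = {w \<in> observed G. (w, v) \<in> edges G}"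

definition parents_unobs :: "'w causal_graph \<Rightarrow> 'w \<Rightarrow> 'w set" where
  "parents_unobs G v = {w \<in> unobserved G. (w, v) \<in> edges G}"

definition children :: "'w causal_graph \<Rightarrow> 'w \<Rightarrow> 'w set" where
  "children G v = {w. (v, w) \<in> edges G}"

definition descendant :: "'w causal_graph \<Rightarrow> 'w \<Rightarrow> 'w \<Rightarrow> bool" where
  "descendant G v w \<longleftrightarrow> (v, w) \<in> (edges G)\<^sup>+"

definition bidirected :: "'w causal_graph \<Rightarrow> 'w \<Rightarrow> 'w \<Rightarrow> bool" where
  "bidirected G v1 v2 \<longleftrightarrow> parents_unobs G v1 \<inter> parents_unobs G v2 \<noteq> {}"


section \<open>d-separation\<close>

text \<open>Paths run through observed and unobserved nodes; a bi-directed edge between \<open>v1\<close> and \<open>v2\<close> is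
  traversed as \<open>[v1, u, v2]\<close>, with \<open>u\<close> an unobserved common parent. The one-node path joins a
  node to itself, so sets sharing a node outside the conditioning set are never d-separated.\<close>

definition is_path :: "'w causal_graph \<Rightarrow> 'w list \<Rightarrow> 'w \<Rightarrow> 'w \<Rightarrow> bool" where
  "is_path G p w1 w2 \<longleftrightarrow>
     p \<noteq> [] \<and> hd p = w1 \<and> last p = w2 \<and> distinct p \<and> set p \<subseteq> nodes G \<and>
     (\<forall>i. Suc i < length p \<longrightarrow>
        (p ! i, p ! Suc i) \<in> edges G \<or> (p ! Suc i, p ! i) \<in> edges G)"

definition collider :: "'w causal_graph \<Rightarrow> 'w list \<Rightarrow> nat \<Rightarrow> bool" where
  "collider G p i \<longleftrightarrow>
     0 < i \<and> Suc i < length p \<and>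
     (p ! (i - 1), p ! i) \<in> edges G \<and> (p ! Suc i, p ! i) \<in> edges G"

definition blocked :: "'w causal_graph \<Rightarrow> 'w list \<Rightarrow> 'w set \<Rightarrow> bool" where
  "blocked G p Z \<longleftrightarrow>
     (\<exists>i < length p.
        (\<not> collider G p i \<and> p ! i \<in> Z) \<or>
        (collider G p i \<and> p ! i \<notin> Z \<and> (\<forall>d. descendant G (p ! i) d \<longrightarrow> d \<notin> Z)))"

definition d_separated :: "'w causal_graph \<Rightarrow> 'w set \<Rightarrow> 'w set \<Rightarrow> 'w set \<Rightarrow> bool" where
  "d_separated G A B Z \<longleftrightarrow>
     (\<forall>a \<in> A. \<forall>b \<in> B. \<forall>p. is_path G p a b \<longrightarrow> blocked G p Z)"


section \<open>Semi-Markovian causal models\<close>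

text \<open>Observed variables are discrete: \<open>v\<close> takes values in the countable set \<open>vals M v\<close>. Unobserved
  variables may live on arbitrary probability spaces. \<open>cpd M v x u\<close> is the law of \<open>v\<close> given the
  values \<open>x\<close> of its observed parents and \<open>u\<close> of its unobserved parents.\<close>

record ('w, 'a, 'l) smcm =
  graph :: "'w causal_graph"
  vals :: "'w \<Rightarrow> 'a set"
  latent :: "'w \<Rightarrow> 'l measure"
  cpd :: "'w \<Rightarrow> ('w \<Rightarrow> 'a) \<Rightarrow> ('w \<Rightarrow> 'l) \<Rightarrow> 'a pmf"

text \<open>The unobserved variables are roots of the graph, so their joint distribution is the product
  of their marginals; every dependence between observed variables due to latent confounding is
  mediated by a shared unobserved parent.\<close>

definition latent_dist :: "('w, 'a, 'l) smcm \<Rightarrow> ('w \<Rightarrow> 'l) measure" where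
  "latent_dist M = PiM (unobserved (graph M)) (latent M)"

definition is_smcm :: "('w, 'a, 'l) smcm \<Rightarrow> bool" where
  "is_smcm M \<longleftrightarrow>
     is_causal_graph (graph M) \<and>
     (\<forall>v \<in> observed (graph M). countable (vals M v)) \<and>
     (\<forall>w \<in> unobserved (graph M). prob_space (latent M w)) \<and>
     (\<forall>v \<in> observed (graph M). \<forall>x \<in> PiE (parents_obs (graph M) v) (vals M).
        (\<forall>u \<in> space (PiM (parents_unobs (graph M) v) (latent M)).
           set_pmf (cpd M v x u) \<subseteq> vals M v) \<and>
        (\<forall>a \<in> vals M v.
           (\<lambda>u. pmf (cpd M v x u) a)
             \<in> borel_measurable (PiM (parents_unobs (graph M) v) (latent M))))"

definition assignments :: "('w, 'a, 'l) smcm \<Rightarrow> ('w \<Rightarrow> 'a) set" where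
  "assignments M = PiE (observed (graph M)) (vals M)"

definition cond_prob :: "('w, 'a, 'l) smcm \<Rightarrow> 'w \<Rightarrow> ('w \<Rightarrow> 'a) \<Rightarrow> ('w \<Rightarrow> 'l) \<Rightarrow> real" where
  "cond_prob M v x u =
     pmf (cpd M v (restrict x (parents_obs (graph M) v)) (restrict u (parents_unobs (graph M) v)))
         (x v)"

definition obs_dist :: "('w, 'a, 'l) smcm \<Rightarrow> ('w \<Rightarrow> 'a) \<Rightarrow> real" where
  "obs_dist M x = (\<integral>u. (\<Prod>v \<in> observed (graph M). cond_prob M v x u) \<partial>latent_dist M)"

definition do_dist ::
  "('w, 'a, 'l) smcm \<Rightarrow> 'w set \<Rightarrow> ('w \<Rightarrow> 'a) \<Rightarrow> ('w \<Rightarrow> 'a) \<Rightarrow> real" where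
  "do_dist M R r x =
     of_bool (\<forall>v \<in> R. x v = r v) *
     (\<integral>u. (\<Prod>v \<in> observed (graph M) - R. cond_prob M v x u) \<partial>latent_dist M)"

text \<open>\<open>marginal X P S s\<close> is the mass that \<open>P\<close>, a mass function on the set \<open>X\<close> of full
  assignments, gives to the event that the variables in \<open>S\<close> have the values prescribed by \<open>s\<close>.\<close>

definition marginal ::
  "('w \<Rightarrow> 'a) set \<Rightarrow> (('w \<Rightarrow> 'a) \<Rightarrow> real) \<Rightarrow> 'w set \<Rightarrow> ('w \<Rightarrow> 'a) \<Rightarrow> real" where
  "marginal X P S s = (\<Sum>\<^sub>\<infinity>x \<in> {x \<in> X. \<forall>v \<in> S. x v = s v}. P x)"

text \<open>\<open>causal_effect M t \<tau> y \<eta>\<close> is the probability that \<open>y\<close> equals \<open>\<eta>\<close> when \<open>t\<close> is forced to \<open>\<tau>\<close>.\<close>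

definition causal_effect :: "('w, 'a, 'l) smcm \<Rightarrow> 'w \<Rightarrow> 'a \<Rightarrow> 'w \<Rightarrow> 'a \<Rightarrow> real" where
  "causal_effect M t \<tau> y \<eta> =
     marginal (assignments M) (do_dist M {t} (\<lambda>_. \<tau>)) {y} (\<lambda>_. \<eta>)"

text \<open>The graph and the observational distribution in question are those of \<open>M\<close>. Competing
  models share the value sets of the observed variables, but are free in the probability spaces and
  laws of the unobserved ones and in the conditional distributions. HOL cannot quantify over types,
  so the type \<open>'k\<close> carrying the competitors' unobserved variables is a parameter; it is unrelated
  to the one used by \<open>M\<close>, and a statement with \<open>'k\<close> free covers all competitors.\<close>

definition identifiable ::
  "'k itself \<Rightarrow> ('w, 'a, 'l) smcm \<Rightarrow> 'w \<Rightarrow> 'a \<Rightarrow> 'w \<Rightarrow> bool" where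
  "identifiable (_ :: 'k itself) M t \<tau> y \<longleftrightarrow>
     (\<forall>M' :: ('w, 'a, 'k) smcm.
        is_smcm M' \<and> graph M' = graph M \<and>
        (\<forall>v \<in> observed (graph M). vals M' v = vals M v) \<and>
        (\<forall>x \<in> assignments M. obs_dist M' x = obs_dist M x)
        \<longrightarrow> (\<forall>\<eta> \<in> vals M y. causal_effect M' t \<tau> y \<eta> = causal_effect M t \<tau> y \<eta>))"


section \<open>Conditional independence and faithfulness\<close>

text \<open>\<open>P(a, b, z) P(z) = P(a, z) P(b, z)\<close> for all values, i.e. the usual identity
  \<open>P(a, b | z) = P(a | z) P(b | z)\<close> with denominators cleared. It refers to the mass function \<open>P\<close>
  on the set \<open>X\<close> of assignments only, not to a graph.\<close>

definition cond_indep ::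
  "('w \<Rightarrow> 'a) set \<Rightarrow> (('w \<Rightarrow> 'a) \<Rightarrow> real) \<Rightarrow> 'w set \<Rightarrow> 'w set \<Rightarrow> 'w set \<Rightarrow> bool" where
  "cond_indep X P A B Z \<longleftrightarrow>
     (\<forall>x \<in> X. marginal X P (A \<union> B \<union> Z) x * marginal X P Z x =
               marginal X P (A \<union> Z) x * marginal X P (B \<union> Z) x)"

definition faithful :: "('w, 'a, 'l) smcm \<Rightarrow> bool" where
  "faithful M \<longleftrightarrow>
     (\<forall>w1 \<in> observed (graph M). \<forall>w2 \<in> observed (graph M).
      \<forall>Z \<subseteq> observed (graph M) - {w1, w2}.
        w1 \<noteq> w2 \<and> cond_indep (assignments M) (obs_dist M) {w1} {w2} Z \<longrightarrow>
        d_separated (graph M) {w1} {w2} Z)"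

end

theory Submission
  imports Defs
begin

text \<open>Write \<open>q C\<close> for the expectation over the latent variables of the product of the conditional
  probabilities of the variables in \<open>C\<close>. Summing out a variable without children in \<open>C\<close> deletes it
  from \<open>C\<close>, and \<open>q (C \<union> D) = q C * q D\<close> if \<open>C\<close> and \<open>D\<close> share no latent parent.

  Let \<open>Z = {t} \<union> z\<close> and let \<open>A\<close> be the set of observed ancestors of \<open>y\<close>. Let \<open>K \<subseteq> A\<close> consist of the
  variables in \<open>b\<close> and of those reached by an open walk from \<open>b\<close> that ends with an arrowhead, and
  \<open>S = A - K\<close>. If \<open>w \<in> K\<close> shared a latent parent with \<open>v \<in> S\<close>, the open walk to \<open>w\<close> would continue
  to \<open>v\<close>, or, where \<open>w\<close> is no ancestor of \<open>Z\<close>, along a directed path to \<open>y\<close>, which d-separation forbids;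
  and if \<open>t \<in> K\<close>, it would continue from \<open>t\<close> through the confounder to \<open>y\<close>. So
  \<open>q A = q S * q K\<close>, the variable \<open>t\<close> is in \<open>S\<close> and has no children there, and the effect is
  obtained by summing \<open>q (A - {t}) = q (S - {t}) * q K\<close>, where \<open>q (S - {t})\<close> is \<open>q S\<close> with \<open>t\<close> summed
  out. The factors \<open>q S\<close> and \<open>q K\<close> are determined by the observational distribution: build up
  ancestral subsets of \<open>A\<close> one sink at a time; each new variable changes only one of the two
  factors, and the other one, being positive, can be cancelled.

  For the equivalence, d-separation implies conditional independence by the same factorisation,
  applied to the ancestors of \<open>b \<union> {y} \<union> Z\<close> and to the variables whose family meets the set of
  nodes reachable from \<open>b\<close>. The converse is faithfulness, applied to one element of \<open>b\<close> at a time.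
  If \<open>y \<in> b\<close>, conditional independence would make \<open>y\<close> constant, hence independent of
  \<open>t\<close>, against faithfulness and the confounder.\<close>

section \<open>Open walks\<close>

text \<open>The reflexive closure makes this the exact condition under which \<open>Z\<close> leaves
  a collider open: the node or one of its descendants lies in \<open>Z\<close>.\<close>

definition ancestral_to :: "'w causal_graph \<Rightarrow> 'w set \<Rightarrow> 'w \<Rightarrow> bool" where
  "ancestral_to G Z w \<longleftrightarrow> (\<exists>z\<in>Z. (w, z) \<in> (edges G)\<^sup>*)"

lemma ancestral_to_self: "w \<in> Z \<Longrightarrow> ancestral_to G Z w"
  unfolding ancestral_to_def by blast

lemma ancestral_to_step: "(v, w) \<in> edges G \<Longrightarrow> ancestral_to G Z w \<Longrightarrow> ancestral_to G Z v"
  unfolding ancestral_to_def by (meson converse_rtrancl_into_rtrancl)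

lemma ancestral_to_rtrancl: "(v, w) \<in> (edges G)\<^sup>* \<Longrightarrow> ancestral_to G Z w \<Longrightarrow> ancestral_to G Z v"
  unfolding ancestral_to_def by (meson rtrancl_trans)

text \<open>Unlike \<open>is_path\<close>, nodes may repeat, so that appending an edge needs no
  distinctness check.\<close>

definition walk :: "'w causal_graph \<Rightarrow> 'w list \<Rightarrow> bool" where
  "walk G p \<longleftrightarrow> p \<noteq> [] \<and> set p \<subseteq> nodes G \<and>
     (\<forall>i. Suc i < length p \<longrightarrow> (p ! i, p ! Suc i) \<in> edges G \<or> (p ! Suc i, p ! i) \<in> edges G)"

definition open_at :: "'w causal_graph \<Rightarrow> 'w set \<Rightarrow> 'w list \<Rightarrow> nat \<Rightarrow> bool" where
  "open_at G Z p i \<longleftrightarrow> (if collider G p i then ancestral_to G Z (p ! i) else p ! i \<notin> Z)"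

lemma open_at_iff_not_blocked: "(\<forall>i < length p. open_at G Z p i) \<longleftrightarrow> \<not> blocked G p Z"
  unfolding open_at_def blocked_def ancestral_to_def descendant_def
  by (auto simp: rtrancl_eq_or_trancl)

text \<open>The first reversal of direction after index \<open>i\<close> would be a collider
  descending from \<open>p ! i\<close>. Being open, it would make \<open>p ! i\<close> ancestral to
  \<open>Z\<close>.\<close>

lemma open_walk_forward:
  assumes w: "walk G p" and op: "\<forall>k < length p. open_at G Z p k"
    and i: "(p ! i, p ! Suc i) \<in> edges G" "i < m" "m < length p"
    and na: "\<not> ancestral_to G Z (p ! i)"
  shows "(p ! i, p ! m) \<in> (edges G)\<^sup>+ \<and> (p ! (m - 1), p ! m) \<in> edges G"
  using i(2,3)
proof (induction m)
  case (Suc m)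
  show ?case
  proof (cases "m = i")
    case False
    with Suc have IH: "(p ! i, p ! m) \<in> (edges G)\<^sup>+" "(p ! (m - 1), p ! m) \<in> edges G" by auto
    have "(p ! Suc m, p ! m) \<notin> edges G"
    proof
      assume "(p ! Suc m, p ! m) \<in> edges G"
      with IH Suc False have "collider G p m" by (auto simp: collider_def)
      with op Suc have "ancestral_to G Z (p ! m)" by (auto simp: open_at_def)
      with IH na show False by (meson ancestral_to_rtrancl trancl_into_rtrancl)
    qed
    with w Suc have "(p ! m, p ! Suc m) \<in> edges G" by (auto simp: walk_def)
    with IH show ?thesis by (auto intro: trancl_into_trancl)
  qed (use i in auto)
qed simp

text \<open>Away from the splice every node keeps its neighbours, hence its status as a collider, so
  only index \<open>i\<close> of the shortened walk needs an argument.\<close>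

lemma open_walk_splice:
  assumes ac: "acyclic (edges G)" and w: "walk G p" and op: "\<forall>k < length p. open_at G Z p k"
    and ij: "i < j" "j < length p" "p ! i = p ! j"
  defines "q \<equiv> take i p @ drop j p"
  shows "walk G q \<and> (\<forall>k < length q. open_at G Z q k) \<and> hd q = hd p \<and> last q = last p"
proof -
  have lenq: "length q = i + (length p - j)" using ij by (simp add: q_def)
  have q1: "q ! k = p ! k" if "k \<le> i" for k using that ij by (auto simp: q_def nth_append)
  have q2: "q ! k = p ! (k + j - i)" if "i \<le> k" "k < length q" for k
    using that ij lenq by (auto simp: q_def nth_append)
      (metis Nat.diff_add_assoc2 add.commute)+
  have ends: "hd q = hd p" "last q = last p"
    using ij q1[of 0] w by (auto simp: q_def walk_def hd_conv_nth)
  have wq: "walk G q"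
    unfolding walk_def
  proof (intro conjI allI impI)
    show "q \<noteq> []" using ij by (simp add: q_def)
    show "set q \<subseteq> nodes G" using w by (auto simp: q_def walk_def dest: in_set_takeD in_set_dropD)
    fix k assume k: "Suc k < length q"
    show "(q ! k, q ! Suc k) \<in> edges G \<or> (q ! Suc k, q ! k) \<in> edges G"
    proof (cases "k < i")
      case True then show ?thesis using q1[of k] q1[of "Suc k"] w ij by (auto simp: walk_def)
    next
      case False
      then have "q ! k = p ! (k + j - i)" "q ! Suc k = p ! Suc (k + j - i)" "Suc (k + j - i) < length p"
        using q2[of k] q2[of "Suc k"] k lenq ij by (auto simp: Suc_diff_le)
      then show ?thesis using w by (auto simp: walk_def)
    qed
  qed
  have "open_at G Z q k" if k: "k < length q" for k
  proof -
    consider "k < i" | "k > i" | "k = i" by linarith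
    then show ?thesis
    proof cases
      case 1
      then have "collider G q k = collider G p k"
        using q1[of "k-1"] q1[of k] q1[of "Suc k"] ij lenq by (auto simp: collider_def)
      moreover have "k < length p" using 1 ij by simp
      ultimately show ?thesis using op 1 q1[of k] by (auto simp: open_at_def)
    next
      case 2
      let ?k = "k + j - i"
      have "q ! k = p ! ?k" "q ! (k - 1) = p ! (?k - 1)" "?k < length p" "0 < ?k"
        using 2 q2[of k] q2[of "k-1"] k lenq ij by auto
      moreover have "Suc k < length q \<longleftrightarrow> Suc ?k < length p" using 2 lenq ij by auto
      moreover have "Suc k < length q \<Longrightarrow> q ! Suc k = p ! Suc ?k"
        using 2 q2[of "Suc k"] ij by (auto simp: Suc_diff_le)
      ultimately have "collider G q k = collider G p ?k" using 2 by (auto simp: collider_def)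
      then show ?thesis using op \<open>?k < length p\<close> \<open>q ! k = p ! ?k\<close> by (auto simp: open_at_def)
    next
      case 3
      \<comment> \<open>At the splice the two neighbours come from different visits of the same node. If it is a new
        collider, the walk left its first visit forwards; by acyclicity it met a collider before
        coming back.\<close>
      have qi: "q ! i = p ! i" using q1[of i] by simp
      have pr: "q ! (i - 1) = p ! (i - 1)" using q1[of "i-1"] by simp
      have nx: "Suc i < length q \<Longrightarrow> q ! Suc i = p ! Suc j" using q2[of "Suc i"] by (simp)
      have ln: "Suc i < length q \<longleftrightarrow> Suc j < length p" using lenq ij by auto
      have opi: "open_at G Z p i" and opj: "open_at G Z p j" using op ij by auto
      show ?thesis
      proof (cases "collider G q i")
        case True
        then have c: "0 < i" "(p ! (i - 1), p ! i) \<in> edges G" using pr qi by (auto simp: collider_def)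
        have "ancestral_to G Z (p ! i)"
        proof (rule ccontr)
          assume na: "\<not> ancestral_to G Z (p ! i)"
          then have "\<not> collider G p i" using opi by (auto simp: open_at_def)
          with c ij have "(p ! Suc i, p ! i) \<notin> edges G" by (auto simp: collider_def)
          moreover have "Suc i < length p" using ij by simp
          ultimately have "(p ! i, p ! Suc i) \<in> edges G" using w unfolding walk_def by blast
          from open_walk_forward[OF w op this ij(1,2) na] have "(p ! i, p ! i) \<in> (edges G)\<^sup>+"
            using ij by simp
          with ac show False by (auto simp: acyclic_def)
        qed
        with 3 True qi show ?thesis by (simp add: open_at_def)
      next
        case False
        \<comment> \<open>The splice inherits its incoming edge from the first visit and its
          outgoing one from the second, so colliders at both visits would make it a collider. One
          visit is thus an open non-collider, which puts the node outside \<open>Z\<close>.\<close>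
        have "\<not> collider G p i \<or> \<not> collider G p j"
        proof (rule ccontr)
          assume "\<not> ?thesis"
          then have "collider G q i" using pr qi nx ln ij by (auto simp: collider_def)
          with False show False by simp
        qed
        then have "p ! i \<notin> Z" using opi opj ij by (auto simp: open_at_def)
        with 3 False qi show ?thesis by (simp add: open_at_def)
      qed
    qed
  qed
  with wq ends show ?thesis by blast
qed

text \<open>Loops are spliced out by induction on the length until no node repeats.\<close>

lemma open_walk_imp_open_path:
  assumes ac: "acyclic (edges G)"
  shows "walk G p \<Longrightarrow> \<forall>k < length p. open_at G Z p k \<Longrightarrow>
    \<exists>q. is_path G q (hd p) (last p) \<and> \<not> blocked G q Z"
proof (induction p rule: length_induct)
  case (1 p)
  show ?case
  proof (cases "distinct p")
    case True
    with 1 show ?thesis by (auto simp: is_path_def walk_def open_at_iff_not_blocked)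
  next
    case False
    then obtain i j where ij: "i < j" "j < length p" "p ! i = p ! j"
      by (metis distinct_conv_nth linorder_neqE_nat)
    let ?q = "take i p @ drop j p"
    have "length ?q < length p" using ij by simp
    with 1 open_walk_splice[OF ac 1(2,3) ij] show ?thesis by metis
  qed
qed

text \<open>The flag records whether the walk from \<open>B\<close> arrives at the node along an arrowhead, which decides
  how the walk may be continued.\<close>

inductive reach :: "'w causal_graph \<Rightarrow> 'w set \<Rightarrow> 'w set \<Rightarrow> 'w \<Rightarrow> bool \<Rightarrow> bool" for G B Z where
  start: "b \<in> B \<Longrightarrow> reach G B Z b False"
| fwd: "reach G B Z w d \<Longrightarrow> w \<notin> Z \<Longrightarrow> (w, c) \<in> edges G \<Longrightarrow> reach G B Z c True"
| bwd: "reach G B Z w False \<Longrightarrow> w \<notin> Z \<Longrightarrow> (c, w) \<in> edges G \<Longrightarrow> reach G B Z c False"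
| bounce: "reach G B Z w True \<Longrightarrow> ancestral_to G Z w \<Longrightarrow> (c, w) \<in> edges G \<Longrightarrow> reach G B Z c False"

text \<open>The last node is exempt from openness, because only the next edge decides whether it is
  a collider. A one-node walk has flag \<open>False\<close>.\<close>

definition walk_to ::
  "'w causal_graph \<Rightarrow> 'w set \<Rightarrow> 'w set \<Rightarrow> 'w list \<Rightarrow> 'w \<Rightarrow> bool \<Rightarrow> bool" where
  "walk_to G B Z p w d \<longleftrightarrow> walk G p \<and> hd p \<in> B \<and> last p = w \<and>
     (\<forall>i. Suc i < length p \<longrightarrow> open_at G Z p i) \<and>
     (d \<longleftrightarrow> 2 \<le> length p \<and> (p ! (length p - 2), w) \<in> edges G)"

text \<open>The old end \<open>w\<close> becomes an inner node. By acyclicity the flags determine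
  the edge directions, so \<open>w\<close> is a collider exactly if \<open>d\<close> holds and
  \<open>d'\<close> fails; the last premise is the resulting openness condition.\<close>

lemma walk_to_snoc:
  assumes p: "walk_to G B Z p w d" and c: "c \<in> nodes G"
    and e: "(w, c) \<in> edges G \<and> d' \<or> (c, w) \<in> edges G \<and> \<not> d'"
    and ac: "acyclic (edges G)"
    and o: "if d \<and> \<not> d' then ancestral_to G Z w else w \<notin> Z"
  shows "walk_to G B Z (p @ [c]) c d'"
proof -
  let ?n = "length p"
  have ne: "p \<noteq> []" and pl: "p ! (?n - 1) = w"
    using p by (auto simp: walk_to_def walk_def last_conv_nth)
  have asym: "(w, c) \<in> edges G \<Longrightarrow> (c, w) \<notin> edges G"
    using ac by (meson acyclic_def r_into_trancl' trancl_trans)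
  have wk: "walk G (p @ [c])"
    unfolding walk_def
  proof (intro conjI allI impI)
    show "set (p @ [c]) \<subseteq> nodes G" using p c by (auto simp: walk_to_def walk_def)
    fix i assume i: "Suc i < length (p @ [c])"
    show "((p @ [c]) ! i, (p @ [c]) ! Suc i) \<in> edges G \<or> ((p @ [c]) ! Suc i, (p @ [c]) ! i) \<in> edges G"
    proof (cases "Suc i < ?n")
      case True then show ?thesis using p by (auto simp: walk_to_def walk_def nth_append)
    next
      case False
      then have "i = ?n - 1" using i by simp
      then show ?thesis using e pl ne by (auto simp: nth_append)
    qed
  qed simp
  have op: "open_at G Z (p @ [c]) i" if i: "Suc i < length (p @ [c])" for i
  proof (cases "Suc i < ?n")
    case True
    then have "collider G (p @ [c]) i = collider G p i" by (auto simp: collider_def nth_append)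
    then show ?thesis using True p by (auto simp: walk_to_def open_at_def nth_append)
  next
    case False
    then have i: "i = ?n - 1" using i by simp
    have "collider G (p @ [c]) i \<longleftrightarrow> d \<and> \<not> d'"
    proof -
      have "?n - 1 - 1 = ?n - 2" by simp
      moreover have "(p @ [c]) ! (?n - 2) = p ! (?n - 2)" "(p @ [c]) ! (?n - 1) = w"
        using ne pl by (auto simp: nth_append)
      moreover have "(p @ [c]) ! Suc (?n - 1) = c" using ne by (simp add: nth_append)
      ultimately show ?thesis
        using p e asym ne unfolding i collider_def walk_to_def
        by (auto simp: Suc_le_eq numeral_2_eq_2)
    qed
    moreover have "(p @ [c]) ! i = w" using i ne pl by (auto simp: nth_append)
    ultimately show ?thesis using o by (auto simp: open_at_def)
  qed
  have "(p @ [c]) ! (length (p @ [c]) - 2) = w"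
    using ne pl by (simp add: nth_append)
  then show ?thesis
    unfolding walk_to_def using wk op p ne e asym by (auto simp: walk_to_def Suc_le_eq)
qed

lemma reach_walk_to:
  assumes G: "is_causal_graph G" and B: "B \<subseteq> nodes G" "B \<inter> Z = {}"
  shows "reach G B Z w d \<Longrightarrow> \<exists>p. walk_to G B Z p w d"
proof (induction rule: reach.induct)
  have ac: "acyclic (edges G)" and sub: "edges G \<subseteq> nodes G \<times> nodes G"
    using G by (auto simp: is_causal_graph_def nodes_def)
  note snoc = walk_to_snoc[OF _ _ _ ac]
  {
    case (start b)
    then show ?case using B by (intro exI[of _ "[b]"]) (auto simp: walk_to_def walk_def)
  next
    case (fwd w d c)
    then show ?case using snoc[of B Z _ w d c True] sub by fastforce
  next
    case (bwd w c)
    then show ?case using snoc[of B Z _ w False c False] sub by fastforce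
  next
    case (bounce w c)
    then show ?case using snoc[of B Z _ w True c False] sub by fastforce
  }
qed

text \<open>A walk reaching \<open>y\<close> is open at its end too, since \<open>y\<close> lies
  outside \<open>Z\<close>, and shortens to an open path. Later arguments use d-separation through
  this fact and work with \<open>reach\<close> alone.\<close>

theorem d_separated_not_reach:
  assumes G: "is_causal_graph G" and B: "B \<subseteq> nodes G" "B \<inter> Z = {}" and y: "y \<notin> Z"
    and sep: "d_separated G B {y} Z"
  shows "\<not> reach G B Z y d"
proof
  assume "reach G B Z y d"
  from reach_walk_to[OF G B this] obtain p where p: "walk_to G B Z p y d" by blast
  have ac: "acyclic (edges G)" using G by (simp add: is_causal_graph_def)
  have "open_at G Z p i" if "i < length p" for i
  proof (cases "Suc i < length p")
    case False
    then have "i = length p - 1" using that by simp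
    then show ?thesis using p y that by (auto simp: open_at_def collider_def walk_to_def walk_def last_conv_nth)
  qed (use p in \<open>auto simp: walk_to_def\<close>)
  then obtain q where "is_path G q (hd p) (last p)" "\<not> blocked G q Z"
    using open_walk_imp_open_path[OF ac] p by (metis walk_to_def)
  then show False using sep p by (auto simp: d_separated_def walk_to_def)
qed

section \<open>Continuing open walks along directed paths\<close>

lemma reach_descend:
  assumes "(v, x) \<in> (edges G)\<^sup>*" "reach G B Z v d" "\<not> ancestral_to G Z v"
  shows "\<exists>d'. reach G B Z x d'"
  using assms(1)
proof induction
  case (step w x)
  then have "w \<notin> Z" using assms(3) by (auto simp: ancestral_to_def)
  with step show ?case by (meson reach.fwd)
qed (use assms in blast)

text \<open>The directed path is traversed backwards from its end in \<open>B\<close>; none of its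
  nodes up to \<open>v\<close> can block, as a node in \<open>Z\<close> would make \<open>v\<close>
  ancestral to \<open>Z\<close>.\<close>

lemma reach_ascend:
  assumes "(v, x) \<in> (edges G)\<^sup>*" "x \<in> B" "\<not> ancestral_to G Z v"
  shows "reach G B Z v False"
  using assms(1,3)
proof (induction rule: converse_rtrancl_induct)
  case (step v w)
  then have "\<not> ancestral_to G Z w" by (meson ancestral_to_step)
  with step show ?case by (meson reach.bwd ancestral_to_self)
qed (use assms in \<open>auto intro: reach.start\<close>)

text \<open>If \<open>v\<close> is ancestral to \<open>Z\<close>, the walk passes through
  \<open>v\<close> to its parent, by \<open>bwd\<close> or \<open>bounce\<close>. Otherwise a
  directed path from \<open>v\<close> to \<open>y\<close> would carry the walk to \<open>y\<close>,
  so \<open>v\<close> is an ancestor of \<open>B\<close> and is also reached backwards from there,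
  with flag \<open>False\<close>.\<close>

lemma reach_parent:
  assumes v: "reach G B Z v d" "\<not> d \<Longrightarrow> v \<notin> Z" and e: "(w, v) \<in> edges G"
    and anc: "ancestral_to G (B \<union> {y} \<union> Z) v" and y: "\<And>d. \<not> reach G B Z y d"
  shows "reach G B Z w False"
proof (cases "ancestral_to G Z v")
  case True
  then show ?thesis using v e by (cases d) (auto intro: reach.bwd reach.bounce)
next
  case False
  then obtain x where x: "x \<in> B \<union> {y}" "(v, x) \<in> (edges G)\<^sup>*" using anc by (auto simp: ancestral_to_def)
  have "x \<noteq> y" using reach_descend[OF x(2) v(1) False] y by blast
  then have "reach G B Z v False" using reach_ascend[OF x(2) _ False] x by blast
  then show ?thesis using e False by (meson reach.bwd ancestral_to_self)
qed

section \<open>Summing out variables\<close>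

text \<open>Values in \<open>ennreal\<close> make every sum meaningful and allow interchange without
  summability conditions. The head of the list is the outermost sum.\<close>

primrec sum_out ::
  "('w \<Rightarrow> 'a set) \<Rightarrow> 'w list \<Rightarrow> (('w \<Rightarrow> 'a) \<Rightarrow> ennreal) \<Rightarrow> ('w \<Rightarrow> 'a) \<Rightarrow> ennreal" where
  "sum_out F [] f s = f s"
| "sum_out F (v # vs) f s = (\<integral>\<^sup>+a. sum_out F vs f (s(v := a)) \<partial>count_space (F v))"

definition ignores :: "(('w \<Rightarrow> 'a) \<Rightarrow> 'b) \<Rightarrow> 'w \<Rightarrow> bool" where
  "ignores f v \<longleftrightarrow> (\<forall>x a. f (x(v := a)) = f x)"

lemma sum_out_append: "sum_out F (vs @ ws) f s = sum_out F vs (sum_out F ws f) s"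
  by (induction vs arbitrary: s) auto

lemma fun_upd_mem_PiE: "s \<in> PiE V F \<Longrightarrow> v \<in> V \<Longrightarrow> a \<in> F v \<Longrightarrow> s(v := a) \<in> PiE V F"
  using PiE_fun_upd[of a F v s V] by (simp add: insert_absorb)

lemma sum_out_cong:
  assumes "s \<in> PiE V F" "set vs \<subseteq> V"
    and "\<And>v. v \<in> V \<Longrightarrow> F' v = F v" "\<And>x. x \<in> PiE V F \<Longrightarrow> f x = g x"
  shows "sum_out F vs f s = sum_out F' vs g s"
  using assms(1,2)
proof (induction vs arbitrary: s)
  case (Cons v vs)
  then show ?case using assms(3)[of v] by (auto intro!: nn_integral_cong Cons.IH fun_upd_mem_PiE)
qed (simp add: assms(4))

lemma sum_out_ignores: "ignores g w \<Longrightarrow> ignores (sum_out F vs g) w"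
proof (induction vs)
  case (Cons v vs)
  then have IH: "sum_out F vs g (x(w := b)) = sum_out F vs g x" for x b by (auto simp: ignores_def)
  have "sum_out F vs g (x(w := b, v := a)) = sum_out F vs g (x(v := a))" for x a b
    by (cases "w = v") (simp_all add: fun_upd_twist[of w v] IH)
  then show ?case by (simp add: ignores_def)
qed (simp add: ignores_def)

lemma sum_out_mult_left:
  "(\<And>v. v \<in> set vs \<Longrightarrow> ignores f v) \<Longrightarrow> sum_out F vs (\<lambda>x. f x * g x) s = f s * sum_out F vs g s"
  by (induction vs arbitrary: s) (auto simp: nn_integral_cmult ignores_def)

lemma sum_out_mult_right:
  "(\<And>v. v \<in> set vs \<Longrightarrow> ignores g v) \<Longrightarrow> sum_out F vs (\<lambda>x. f x * g x) s = sum_out F vs f s * g s"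
  using sum_out_mult_left[of vs g F f s] by (simp add: mult.commute)

text \<open>The inner sums over \<open>ws\<close> treat \<open>f\<close> as a constant; their result
  still ignores \<open>vs\<close> and leaves the outer sums as a constant.\<close>

lemma sum_out_mult:
  assumes "\<And>v. v \<in> set ws \<Longrightarrow> ignores f v" "\<And>v. v \<in> set vs \<Longrightarrow> ignores g v"
  shows "sum_out F (vs @ ws) (\<lambda>x. f x * g x) s = sum_out F vs f s * sum_out F ws g s"
proof -
  have "sum_out F ws (\<lambda>x. f x * g x) = (\<lambda>x. f x * sum_out F ws g x)"
    using assms(1) by (auto simp: sum_out_mult_left fun_eq_iff)
  then show ?thesis
    using assms(2) by (simp add: sum_out_append sum_out_mult_right sum_out_ignores)
qed

definition fixing :: "('w \<Rightarrow> 'a) set \<Rightarrow> 'w set \<Rightarrow> ('w \<Rightarrow> 'a) \<Rightarrow> ('w \<Rightarrow> 'a) set" where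
  "fixing X S s = {x \<in> X. \<forall>v \<in> S. x v = s v}"

text \<open>Tonelli's theorem for counting measures, applied to one variable at a time.\<close>

lemma nn_integral_fixing_eq_sum_out:
  assumes "s \<in> PiE V F" "distinct vs" "set vs = V - S" "S \<subseteq> V"
  shows "(\<integral>\<^sup>+x. f x \<partial>count_space (fixing (PiE V F) S s)) = sum_out F vs f s"
  using assms
proof (induction vs arbitrary: s S)
  case Nil
  then have "fixing (PiE V F) S s = {s}" by (auto simp: fixing_def intro: PiE_ext)
  then show ?case by (simp add: nn_integral_count_space_finite)
next
  case (Cons v vs)
  then have v: "v \<in> V" "v \<notin> S" by auto
  let ?X = "fixing (PiE V F)"
  \<comment> \<open>The indicator of \<open>{x v}\<close> ties \<open>a\<close> to the value of
    \<open>x\<close> at \<open>v\<close>: summing \<open>?h\<close> over \<open>x\<close> gives the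
    inner sum for \<open>a\<close>, and summing it over \<open>a\<close> gives back the original
    summand.\<close>
  let ?h = "\<lambda>(a, x). f x * indicator (?X S s) x * indicator {x v} a"
  have IH: "sum_out F vs f (s(v := a)) = (\<integral>\<^sup>+x. ?h (a, x) \<partial>count_space UNIV)" if "a \<in> F v" for a
  proof -
    have "sum_out F vs f (s(v := a)) = (\<integral>\<^sup>+x. f x \<partial>count_space (?X (insert v S) (s(v := a))))"
      using Cons that v by (intro Cons.IH[symmetric] fun_upd_mem_PiE) auto
    also have "\<dots> = (\<integral>\<^sup>+x. f x * indicator (?X (insert v S) (s(v := a))) x \<partial>count_space UNIV)"
      by (simp add: nn_integral_count_space_indicator)
    also have "\<dots> = (\<integral>\<^sup>+x. ?h (a, x) \<partial>count_space UNIV)"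
      using v by (intro nn_integral_cong) (auto simp: fixing_def split: split_indicator)
    finally show ?thesis .
  qed
  have "sum_out F (v # vs) f s = (\<integral>\<^sup>+a. (\<integral>\<^sup>+x. ?h (a, x) \<partial>count_space UNIV) \<partial>count_space (F v))"
    unfolding sum_out.simps by (intro nn_integral_cong IH) simp
  also have "\<dots> = (\<integral>\<^sup>+a. (\<integral>\<^sup>+x. ?h (a, x) \<partial>count_space UNIV) \<partial>count_space UNIV)"
  proof (intro nn_integral_count_space_eq)
    fix a assume "a \<in> UNIV - F v"
    then have "?h (a, x) = 0" for x
      using v by (auto simp: fixing_def split: split_indicator)
    then show "(\<integral>\<^sup>+x. ?h (a, x) \<partial>count_space UNIV) = 0" by (simp only: nn_integral_const mult_zero_left)
  qed simp
  also have "\<dots> = (\<integral>\<^sup>+x. (\<integral>\<^sup>+a. ?h (a, x) \<partial>count_space UNIV) \<partial>count_space UNIV)"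
    unfolding nn_integral_fst_count_space nn_integral_snd_count_space ..
  also have "\<dots> = (\<integral>\<^sup>+x. f x * indicator (?X S s) x \<partial>count_space UNIV)"
    by (intro nn_integral_cong) (simp add: nn_integral_cmult_indicator)
  also have "\<dots> = (\<integral>\<^sup>+x. f x \<partial>count_space (?X S s))"
    by (simp add: nn_integral_count_space_indicator)
  finally show ?case ..
qed

text \<open>Both orders compute the same single sum over the assignments that agree with
  \<open>s\<close> outside the list.\<close>

lemma sum_out_perm:
  assumes "s \<in> PiE V F" "distinct vs" "distinct ws" "set vs = set ws" "set vs \<subseteq> V"
  shows "sum_out F vs f s = sum_out F ws f s"
  using nn_integral_fixing_eq_sum_out[of s V F vs "V - set vs" f]
    nn_integral_fixing_eq_sum_out[of s V F ws "V - set vs" f] assms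
  by (metis Diff_subset double_diff subset_refl)

text \<open>The defaults agree when the sum diverges: \<open>infsum\<close>, the Bochner integral
  and \<open>enn2real \<top>\<close> are all 0.\<close>

lemma marginal_eq_enn2real:
  assumes "\<And>x. x \<in> X \<Longrightarrow> 0 \<le> P x"
  shows "marginal X P S s = enn2real (\<integral>\<^sup>+x. ennreal (P x) \<partial>count_space (fixing X S s))"
proof -
  let ?A = "fixing X S s"
  have nn: "0 \<le> P x" if "x \<in> ?A" for x using assms that by (auto simp: fixing_def)
  have I: "integral\<^sup>L (count_space ?A) P = enn2real (\<integral>\<^sup>+x. ennreal (P x) \<partial>count_space ?A)"
    using nn by (intro integral_eq_nn_integral) (auto simp: AE_count_space)
  have "infsum P ?A = integral\<^sup>L (count_space ?A) P"
  proof (cases "integrable (count_space ?A) P")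
    case True
    then show ?thesis by (metis infsetsum_infsum infsetsum_def abs_summable_on_def)
  next
    case False
    have "\<not> P summable_on ?A"
    proof
      assume "P summable_on ?A"
      then have "(\<lambda>x. norm (P x)) summable_on ?A" using nn by (subst summable_on_cong[of _ _ P]) auto
      with False show False by (simp only: abs_summable_equivalent abs_summable_on_def)
    qed
    then have "infsum P ?A = 0" by (rule infsum_not_exists)
    with False show ?thesis by (simp add: not_integrable_integral_eq abs_summable_on_def)
  qed
  with I show ?thesis by (simp add: marginal_def fixing_def)
qed

section \<open>Factors of the observational distribution\<close>

text \<open>This is \<open>q C\<close> of the overview, often written \<open>Q[C]\<close>: the law
  of \<open>C\<close> when all other observed variables are forced to their values in
  \<open>x\<close>.\<close>

definition c_factor :: "('w, 'a, 'l) smcm \<Rightarrow> 'w set \<Rightarrow> ('w \<Rightarrow> 'a) \<Rightarrow> ennreal" where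
  "c_factor M C x = (\<integral>\<^sup>+u. (\<Prod>v \<in> C. ennreal (cond_prob M v x u)) \<partial>latent_dist M)"

lemma cond_prob_nonneg [simp]: "0 \<le> cond_prob M v x u"
  by (simp add: cond_prob_def)

lemma cond_prob_le_1: "cond_prob M v x u \<le> 1"
  by (simp add: cond_prob_def pmf_le_1)

lemma ignores_c_factor:
  assumes "v \<notin> C" "\<And>w. w \<in> C \<Longrightarrow> v \<notin> parents_obs (graph M) w"
  shows "ignores (c_factor M C) v"
  unfolding ignores_def c_factor_def cond_prob_def
proof (intro allI nn_integral_cong prod.cong refl)
  fix x a u w assume w: "w \<in> C"
  with assms have "w \<noteq> v" "v \<notin> parents_obs (graph M) w" by auto
  then show "ennreal (pmf (cpd M w (restrict (x(v := a)) (parents_obs (graph M) w))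
      (restrict u (parents_unobs (graph M) w))) ((x(v := a)) w)) =
    ennreal (pmf (cpd M w (restrict x (parents_obs (graph M) w))
      (restrict u (parents_unobs (graph M) w))) (x w))"
    by simp
qed

section \<open>Factors in a fixed model\<close>

locale causal_model =
  fixes M :: "('w, 'a, 'l) smcm"
  assumes smcm: "is_smcm M"
begin

abbreviation "G \<equiv> graph M"
abbreviation "V \<equiv> observed G"
abbreviation "X \<equiv> PiE V (vals M)"

lemma graph: "is_causal_graph G"
  and finite_V: "finite V"
  and finite_latent: "finite (unobserved G)"
  and acyclic: "acyclic (edges G)"
  and edges_subset: "edges G \<subseteq> nodes G \<times> V"
  and disjoint: "V \<inter> unobserved G = {}"
  and countable_vals: "v \<in> V \<Longrightarrow> countable (vals M v)"
  and prob_space_latent: "w \<in> unobserved G \<Longrightarrow> prob_space (latent M w)"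
  using smcm by (auto simp: is_smcm_def is_causal_graph_def)

lemma finite_edges: "finite (edges G)"
  using finite_subset[OF edges_subset] finite_V finite_latent by (simp add: nodes_def)

lemma not_parent_self: "v \<notin> parents_obs G v"
  using acyclic by (auto simp: parents_obs_def acyclic_def)

lemma parents_obs_subset: "parents_obs G v \<subseteq> V" and parents_unobs_subset: "parents_unobs G v \<subseteq> unobserved G"
  by (auto simp: parents_obs_def parents_unobs_def)

lemma prob_space_latent_dist: "prob_space (latent_dist M)"
  unfolding latent_dist_def by (intro prob_space_PiM prob_space_latent)

lemma restrict_mem: "x \<in> X \<Longrightarrow> restrict x (parents_obs G v) \<in> PiE (parents_obs G v) (vals M)"
  using parents_obs_subset by fastforce

text \<open>The index set \<open>I\<close> is left open so that the lemma serves both the whole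
  latent space and the two halves into which \<open>c_factor_mult\<close> splits it.\<close>

lemma measurable_cond_prob:
  assumes "v \<in> V" "x \<in> X" "parents_unobs G v \<subseteq> I"
  shows "(\<lambda>u. cond_prob M v x u) \<in> borel_measurable (PiM I (latent M))"
  unfolding cond_prob_def
proof (rule measurable_compose[OF measurable_restrict_subset[OF assms(3)]])
  show "(\<lambda>u. pmf (cpd M v (restrict x (parents_obs G v)) u) (x v))
      \<in> borel_measurable (PiM (parents_unobs G v) (latent M))"
    using smcm assms(1,2) restrict_mem[OF assms(2), of v] by (auto simp: is_smcm_def PiE_mem)
qed

lemma measurable_prod_cond_prob:
  assumes "C \<subseteq> V" "x \<in> X" "\<And>v. v \<in> C \<Longrightarrow> parents_unobs G v \<subseteq> I"
  shows "(\<lambda>u. \<Prod>v \<in> C. ennreal (cond_prob M v x u)) \<in> borel_measurable (PiM I (latent M))"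
  using assms by (intro borel_measurable_prod_ennreal measurable_compose[OF measurable_cond_prob]) auto

lemma sum_cond_prob:
  assumes "v \<in> V" "x \<in> X" "u \<in> space (latent_dist M)"
  shows "(\<integral>\<^sup>+a. ennreal (cond_prob M v (x(v := a)) u) \<partial>count_space (vals M v)) = 1"
proof -
  let ?p = "cpd M v (restrict x (parents_obs G v)) (restrict u (parents_unobs G v))"
  have "restrict u (parents_unobs G v) \<in> space (PiM (parents_unobs G v) (latent M))"
    using assms(3) parents_unobs_subset[of v]
    by (auto simp: latent_dist_def space_PiM PiE_iff)
  then have "set_pmf ?p \<subseteq> vals M v"
    using smcm assms(1) restrict_mem[OF assms(2), of v] by (auto simp: is_smcm_def)
  then have "emeasure (measure_pmf ?p) (vals M v) = 1"
    by (intro measure_pmf.emeasure_eq_1_AE) (auto simp: AE_measure_pmf_iff)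
  moreover have "cond_prob M v (x(v := a)) u = pmf ?p a" for a
    using not_parent_self[of v] by (simp add: cond_prob_def)
  ultimately show ?thesis by (simp add: nn_integral_pmf)
qed

text \<open>After exchanging the sum with the latent expectation, only the factor of
  \<open>v\<close> itself depends on the value of \<open>v\<close>, and that factor sums to
  1.\<close>

lemma sum_c_factor:
  assumes x: "x \<in> X" and C: "C \<subseteq> V" "v \<in> C" and np: "\<And>w. w \<in> C \<Longrightarrow> v \<notin> parents_obs G w"
  shows "(\<integral>\<^sup>+a. c_factor M C (x(v := a)) \<partial>count_space (vals M v)) = c_factor M (C - {v}) x"
proof -
  let ?c = "\<lambda>w a u. ennreal (cond_prob M w (x(v := a)) u)"
  let ?L = "latent_dist M" and ?F = "count_space (vals M v)"
  have v: "v \<in> V" and fC: "finite C" using C finite_V by (auto intro: finite_subset)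
  interpret L: prob_space ?L by (rule prob_space_latent_dist)
  interpret F: sigma_finite_measure ?F
    using countable_vals[OF v] by (rule sigma_finite_measure_count_space_countable)
  interpret FL: pair_sigma_finite ?F ?L ..
  \<comment> \<open>Since \<open>vals M v\<close> is countable, joint measurability reduces to
    measurability in \<open>u\<close> for each value \<open>a\<close>.\<close>
  have meas: "(\<lambda>(a, u). \<Prod>w\<in>C. ?c w a u) \<in> borel_measurable (?F \<Otimes>\<^sub>M ?L)"
  proof (rule measurable_pair_measure_countable1[OF countable_vals[OF v]])
    fix a assume "a \<in> vals M v"
    then have "x(v := a) \<in> X" using x v by (intro fun_upd_mem_PiE)
    then show "(\<lambda>u. case (a, u) of (a, u) \<Rightarrow> \<Prod>w\<in>C. ?c w a u) \<in> borel_measurable ?L"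
      using measurable_prod_cond_prob[OF C(1)] parents_unobs_subset by (simp add: latent_dist_def)
  qed
  have eq: "?c w a u = ennreal (cond_prob M w x u)" if "w \<in> C - {v}" for w a u
    using that np[of w] by (simp add: cond_prob_def)
  have "(\<integral>\<^sup>+a. c_factor M C (x(v := a)) \<partial>?F) = (\<integral>\<^sup>+u. (\<integral>\<^sup>+a. (\<Prod>w\<in>C. ?c w a u) \<partial>?F) \<partial>?L)"
    unfolding c_factor_def using FL.Fubini'[OF meas] by simp
  also have "\<dots> = c_factor M (C - {v}) x"
    unfolding c_factor_def
  proof (rule nn_integral_cong)
    fix u assume u: "u \<in> space ?L"
    have "(\<Prod>w\<in>C. ?c w a u) = ?c v a u * (\<Prod>w\<in>C - {v}. ennreal (cond_prob M w x u))" for a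
      unfolding prod.remove[OF fC C(2)] using eq by (intro arg_cong2[where f = "(*)"] prod.cong) simp_all
    then show "(\<integral>\<^sup>+a. (\<Prod>w\<in>C. ?c w a u) \<partial>?F) = (\<Prod>w\<in>C - {v}. ennreal (cond_prob M w x u))"
      using sum_cond_prob[OF v x u] by (simp add: nn_integral_multc)
  qed
  finally show ?thesis .
qed

text \<open>The converse of a finite acyclic relation is well-founded, and a sink is a minimal
  element of \<open>D\<close> for it.\<close>

lemma obtain_sink:
  assumes "D \<subseteq> V" "D \<noteq> {}"
  obtains v where "v \<in> D" "\<And>w. w \<in> D \<Longrightarrow> v \<notin> parents_obs G w"
proof -
  have "wf ((edges G)\<inverse>)" using finite_edges acyclic by (rule finite_acyclic_wf_converse)
  then obtain v where "v \<in> D" "\<And>w. (w, v) \<in> (edges G)\<inverse> \<Longrightarrow> w \<notin> D"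
    using assms(2) by (metis wfE_min ex_in_conv)
  then show ?thesis by (intro that[of v]) (auto simp: parents_obs_def)
qed

text \<open>A sink of \<open>D\<close> has no child in the rest of \<open>C\<close> either, so it
  can be summed out first. It is put at the end of the list, where the innermost sum stands.\<close>

lemma sum_out_c_factor_ex:
  assumes "D \<subseteq> C" "C \<subseteq> V" "\<And>w. w \<in> C - D \<Longrightarrow> parents_obs G w \<inter> D = {}"
  shows "\<exists>vs. distinct vs \<and> set vs = D \<and>
    (\<forall>x \<in> X. sum_out (vals M) vs (c_factor M C) x = c_factor M (C - D) x)"
proof -
  have "finite D" using assms finite_V by (meson finite_subset)
  then show ?thesis using assms
  proof (induction D arbitrary: C rule: finite_psubset_induct)
    case (psubset D)
    show ?case
    proof (cases "D = {}")
      case False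
      then obtain v where v: "v \<in> D" "\<And>w. w \<in> D \<Longrightarrow> v \<notin> parents_obs G w"
        using obtain_sink[of D] psubset.prems by blast
      then have np: "v \<notin> parents_obs G w" if "w \<in> C" for w using psubset.prems that by blast
      have "\<exists>vs. distinct vs \<and> set vs = D - {v} \<and> (\<forall>x \<in> X.
          sum_out (vals M) vs (c_factor M (C - {v})) x = c_factor M (C - {v} - (D - {v})) x)"
        using psubset.prems v by (intro psubset.IH) auto
      then obtain vs where vs: "distinct vs" "set vs = D - {v}" "\<And>x. x \<in> X \<Longrightarrow>
          sum_out (vals M) vs (c_factor M (C - {v})) x = c_factor M (C - {v} - (D - {v})) x" by blast
      have "C - {v} - (D - {v}) = C - D" using v by auto
      moreover have "sum_out (vals M) (vs @ [v]) (c_factor M C) x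
          = sum_out (vals M) vs (c_factor M (C - {v})) x" if "x \<in> X" for x
        unfolding sum_out_append using that vs(2) v psubset.prems np
        by (intro sum_out_cong[of _ V]) (auto intro!: sum_c_factor)
      ultimately show ?thesis using vs v by (intro exI[of _ "vs @ [v]"]) auto
    qed (auto intro: exI[of _ "[]"])
  qed
qed

lemma sum_out_c_factor:
  assumes "D \<subseteq> C" "C \<subseteq> V" "\<And>w. w \<in> C - D \<Longrightarrow> parents_obs G w \<inter> D = {}"
    and "distinct vs" "set vs = D" "x \<in> X"
  shows "sum_out (vals M) vs (c_factor M C) x = c_factor M (C - D) x"
proof -
  obtain ws where "distinct ws" "set ws = D"
    "sum_out (vals M) ws (c_factor M C) x = c_factor M (C - D) x"
    using sum_out_c_factor_ex[OF assms(1-3)] assms(6) by blast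
  then show ?thesis using assms sum_out_perm[of x V "vals M" vs ws] by auto
qed

lemma c_factor_le_1: "c_factor M C x \<le> 1"
proof -
  interpret prob_space "latent_dist M" by (rule prob_space_latent_dist)
  have "c_factor M C x \<le> (\<integral>\<^sup>+u. 1 \<partial>latent_dist M)"
    unfolding c_factor_def
    by (intro nn_integral_mono prod_le_1) (auto simp: cond_prob_le_1 ennreal_le_1)
  then show ?thesis by (simp add: emeasure_space_1)
qed

lemma c_factor_antimono: "C \<subseteq> D \<Longrightarrow> finite D \<Longrightarrow> c_factor M D x \<le> c_factor M C x"
  unfolding c_factor_def
proof (intro nn_integral_mono)
  fix u assume CD: "C \<subseteq> D" "finite D"
  have "(\<Prod>v\<in>D. ennreal (cond_prob M v x u)) =
      (\<Prod>v\<in>D - C. ennreal (cond_prob M v x u)) * (\<Prod>v\<in>C. ennreal (cond_prob M v x u))"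
    using CD by (rule prod.subset_diff)
  also have "\<dots> \<le> 1 * (\<Prod>v\<in>C. ennreal (cond_prob M v x u))"
    by (intro mult_right_mono prod_le_1) (auto simp: cond_prob_le_1 ennreal_le_1)
  finally show "(\<Prod>v\<in>D. ennreal (cond_prob M v x u)) \<le> (\<Prod>v\<in>C. ennreal (cond_prob M v x u))" by simp
qed

text \<open>The two products depend on disjoint sets of latent coordinates, which are independent
  under the product measure.\<close>

lemma c_factor_mult:
  assumes C: "C1 \<subseteq> V" "C2 \<subseteq> V" "C1 \<inter> C2 = {}" and x: "x \<in> X"
    and np: "\<And>v w. v \<in> C1 \<Longrightarrow> w \<in> C2 \<Longrightarrow> parents_unobs G v \<inter> parents_unobs G w = {}"
  shows "c_factor M (C1 \<union> C2) x = c_factor M C1 x * c_factor M C2 x"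
proof -
  \<comment> \<open>Fubini for product measures asks for a sigma-finite measure at every index, so
    indices that are not latent variables get a one-point space.\<close>
  let ?L = "\<lambda>w. if w \<in> unobserved G then latent M w else count_space {undefined}"
  define I where "I = (\<Union>v\<in>C1. parents_unobs G v)"
  define J where "J = unobserved G - I"
  let ?f = "\<lambda>C u. \<Prod>v\<in>C. ennreal (cond_prob M v x u)"
  have prob: "prob_space (?L w)" for w
    using prob_space_latent[of w] by (auto intro!: prob_spaceI)
  interpret product_sigma_finite ?L
    using prob by (intro product_sigma_finite.intro prob_space_imp_sigma_finite)
  interpret PI: prob_space "PiM I ?L" using prob by (rule prob_space_PiM)
  interpret PJ: prob_space "PiM J ?L" using prob by (rule prob_space_PiM)
  have IJ: "I \<inter> J = {}" "I \<union> J = unobserved G" "finite I" "finite J"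
    using finite_latent parents_unobs_subset by (auto simp: I_def J_def intro: finite_subset)
  have Leq: "PiM K ?L = PiM K (latent M)" if "K \<subseteq> unobserved G" for K
    using that by (intro PiM_cong) auto
  have K: "I \<subseteq> unobserved G" "J \<subseteq> unobserved G" using IJ by auto
  have p1: "parents_unobs G v \<subseteq> I" if "v \<in> C1" for v using that by (auto simp: I_def)
  have p2: "parents_unobs G v \<subseteq> J" if "v \<in> C2" for v
    using that np parents_unobs_subset by (fastforce simp: I_def J_def)
  have m1: "?f C1 \<in> borel_measurable (PiM I ?L)" and m2: "?f C2 \<in> borel_measurable (PiM J ?L)"
    unfolding Leq[OF K(1)] Leq[OF K(2)]
    using measurable_prod_cond_prob[OF C(1) x] measurable_prod_cond_prob[OF C(2) x] p1 p2 by blast+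
  have mU: "?f C \<in> borel_measurable (PiM (I \<union> J) ?L)" if "C \<subseteq> V" for C
    unfolding IJ(2) Leq[OF subset_refl] using that x parents_unobs_subset
    by (auto intro!: measurable_prod_cond_prob)
  have LI: "latent_dist M = PiM (I \<union> J) ?L"
    unfolding IJ(2) Leq[OF subset_refl] latent_dist_def ..
  have e1: "?f C1 (merge I J (a, b)) = ?f C1 a" for a b
  proof (intro prod.cong refl)
    fix v assume "v \<in> C1"
    then have "restrict (merge I J (a, b)) (parents_unobs G v) = restrict a (parents_unobs G v)"
      using p1[of v] by (intro restrict_ext) (auto simp: merge_def)
    then show "ennreal (cond_prob M v x (merge I J (a, b))) = ennreal (cond_prob M v x a)"
      by (simp add: cond_prob_def)
  qed
  have e2: "?f C2 (merge I J (a, b)) = ?f C2 b" for a b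
  proof (intro prod.cong refl)
    fix v assume "v \<in> C2"
    then have "restrict (merge I J (a, b)) (parents_unobs G v) = restrict b (parents_unobs G v)"
      using p2[of v] IJ(1) by (intro restrict_ext) (auto simp: merge_def)
    then show "ennreal (cond_prob M v x (merge I J (a, b))) = ennreal (cond_prob M v x b)"
      by (simp add: cond_prob_def)
  qed
  note fold = product_nn_integral_fold[OF IJ(1,3,4) mU]
  have q1: "c_factor M C1 x = (\<integral>\<^sup>+a. ?f C1 a \<partial>PiM I ?L)"
    unfolding c_factor_def LI fold[OF C(1)] e1 by (simp add: PJ.emeasure_space_1)
  have q2: "c_factor M C2 x = (\<integral>\<^sup>+b. ?f C2 b \<partial>PiM J ?L)"
    unfolding c_factor_def LI fold[OF C(2)] e2 by (simp add: PI.emeasure_space_1)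
  have "finite C1" "finite C2" using C finite_V by (auto intro: finite_subset)
  then have "?f (C1 \<union> C2) u = ?f C1 u * ?f C2 u" for u
    using C(3) by (simp add: prod.union_disjoint)
  then have "c_factor M (C1 \<union> C2) x = (\<integral>\<^sup>+a. (\<integral>\<^sup>+b. ?f C1 a * ?f C2 b \<partial>PiM J ?L) \<partial>PiM I ?L)"
    unfolding c_factor_def LI using fold[of "C1 \<union> C2"] C by (simp add: e1 e2)
  also have "\<dots> = (\<integral>\<^sup>+a. ?f C1 a \<partial>PiM I ?L) * (\<integral>\<^sup>+b. ?f C2 b \<partial>PiM J ?L)"
    using m1 m2 by (simp add: nn_integral_cmult nn_integral_multc)
  finally show ?thesis by (simp add: q1 q2)
qed

lemma ennreal_integral_eq_c_factor:
  assumes "C \<subseteq> V" "x \<in> X"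
  shows "ennreal (\<integral>u. (\<Prod>v \<in> C. cond_prob M v x u) \<partial>latent_dist M) = c_factor M C x"
proof -
  interpret prob_space "latent_dist M" by (rule prob_space_latent_dist)
  have "(\<lambda>u. \<Prod>v \<in> C. cond_prob M v x u) \<in> borel_measurable (latent_dist M)"
    unfolding latent_dist_def using assms parents_unobs_subset
    by (intro borel_measurable_prod measurable_cond_prob) auto
  then have "integrable (latent_dist M) (\<lambda>u. \<Prod>v \<in> C. cond_prob M v x u)"
    by (intro integrable_const_bound[where B = 1])
      (auto simp: abs_prod intro!: prod_le_1 cond_prob_le_1)
  then have "(\<integral>\<^sup>+u. ennreal (\<Prod>v \<in> C. cond_prob M v x u) \<partial>latent_dist M)
      = ennreal (\<integral>u. (\<Prod>v \<in> C. cond_prob M v x u) \<partial>latent_dist M)"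
    by (intro nn_integral_eq_integral) (auto intro!: prod_nonneg)
  then show ?thesis by (simp add: c_factor_def prod_ennreal)
qed

lemma obs_dist_eq_c_factor: "x \<in> X \<Longrightarrow> ennreal (obs_dist M x) = c_factor M V x"
  unfolding obs_dist_def by (rule ennreal_integral_eq_c_factor) simp_all

lemma obs_dist_nonneg: "0 \<le> obs_dist M x"
  unfolding obs_dist_def by (intro Bochner_Integration.integral_nonneg) (auto intro!: prod_nonneg)

section \<open>Probabilities of observed events\<close>

definition event_prob :: "'w set \<Rightarrow> ('w \<Rightarrow> 'a) \<Rightarrow> ennreal" where
  "event_prob S s = (\<integral>\<^sup>+x. c_factor M V x \<partial>count_space (fixing X S s))"

lemma marginal_obs_dist: "marginal (assignments M) (obs_dist M) S s = enn2real (event_prob S s)"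
proof -
  have "(\<integral>\<^sup>+x. ennreal (obs_dist M x) \<partial>count_space (fixing X S s)) = event_prob S s"
    unfolding event_prob_def by (intro nn_integral_cong obs_dist_eq_c_factor) (simp add: fixing_def)
  then show ?thesis by (simp add: marginal_eq_enn2real obs_dist_nonneg assignments_def)
qed

text \<open>Variables outside the parent-closed set \<open>N\<close> have no children in
  \<open>N\<close>; summing over them first leaves the factor of \<open>N\<close>.\<close>

lemma event_prob_eq_sum_out:
  assumes N: "N \<subseteq> V" "\<And>w. w \<in> N \<Longrightarrow> parents_obs G w \<subseteq> N" and "S \<subseteq> N" "s \<in> X"
    and vs: "distinct vs" "set vs = N - S"
  shows "event_prob S s = sum_out (vals M) vs (c_factor M N) s"
proof -
  obtain us where us: "set us = V - N" "distinct us"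
    using finite_distinct_list[of "V - N"] finite_V by auto
  have "event_prob S s = sum_out (vals M) (vs @ us) (c_factor M V) s"
    unfolding event_prob_def using assms us by (intro nn_integral_fixing_eq_sum_out) auto
  also have "\<dots> = sum_out (vals M) vs (c_factor M N) s"
    unfolding sum_out_append
  proof (rule sum_out_cong[of _ V])
    fix x assume "x \<in> X"
    then have "sum_out (vals M) us (c_factor M V) x = c_factor M (V - (V - N)) x"
      using N us by (intro sum_out_c_factor) auto
    then show "sum_out (vals M) us (c_factor M V) x = c_factor M N x" using N by (simp add: double_diff)
  qed (use assms in auto)
  finally show ?thesis .
qed

lemma event_prob_empty: "s \<in> X \<Longrightarrow> event_prob {} s = c_factor M {} s"
  using event_prob_eq_sum_out[of "{}" "{}" s "[]"] by simp

lemma event_prob_finite: "s \<in> X \<Longrightarrow> event_prob S s < \<top>"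
proof -
  assume s: "s \<in> X"
  have "event_prob S s \<le> event_prob {} s"
    unfolding event_prob_def nn_integral_count_space_indicator[of "fixing X _ s", simplified]
    by (intro nn_integral_mono) (auto simp: fixing_def split: split_indicator)
  also have "\<dots> \<le> 1" using event_prob_empty[OF s] c_factor_le_1 by simp
  finally show ?thesis using ennreal_one_less_top by (rule le_less_trans)
qed

lemma c_factor_le_event_prob: "s \<in> X \<Longrightarrow> c_factor M V s \<le> event_prob S s"
proof -
  assume s: "s \<in> X"
  have "c_factor M V s = (\<integral>\<^sup>+x. c_factor M V x * indicator {s} x \<partial>count_space (fixing X S s))"
    using s by (simp add: fixing_def nn_integral_count_space_indicator)
  also have "\<dots> \<le> event_prob S s"
    unfolding event_prob_def by (intro nn_integral_mono) (auto split: split_indicator)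
  finally show ?thesis .
qed

text \<open>All probabilities are finite and \<open>enn2real\<close> is injective on finite values,
  so the identity may be checked in \<open>ennreal\<close>.\<close>

lemma cond_indep_iff_event_prob:
  "cond_indep (assignments M) (obs_dist M) A B Z \<longleftrightarrow>
    (\<forall>x \<in> X. event_prob (A \<union> B \<union> Z) x * event_prob Z x = event_prob (A \<union> Z) x * event_prob (B \<union> Z) x)"
proof -
  have *: "enn2real a = enn2real b \<longleftrightarrow> a = b" if "a < \<top>" "b < \<top>" for a b
    using that by (metis ennreal_enn2real)
  show ?thesis
    unfolding cond_indep_def marginal_obs_dist enn2real_mult[symmetric]
    unfolding assignments_def
    by (intro ball_cong refl *) (auto simp: ennreal_mult_less_top event_prob_finite)
qed

lemma ignores_event_prob: "v \<notin> S \<Longrightarrow> ignores (event_prob S) v"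
proof -
  assume "v \<notin> S"
  then have "fixing X S (x(v := a)) = fixing X S x" for x a by (auto simp: fixing_def)
  then show ?thesis by (simp add: ignores_def event_prob_def)
qed

lemma sum_out_event_prob:
  assumes "S \<subseteq> V" "set us \<subseteq> S" "distinct us" "x \<in> X"
  shows "sum_out (vals M) us (event_prob S) x = event_prob (S - set us) x"
proof -
  obtain vs where vs: "set vs = V - S" "distinct vs"
    using finite_distinct_list[of "V - S"] finite_V by auto
  have "sum_out (vals M) us (event_prob S) x = sum_out (vals M) us (sum_out (vals M) vs (c_factor M V)) x"
    using assms vs parents_obs_subset
    by (intro sum_out_cong[of _ V] event_prob_eq_sum_out) auto
  also have "\<dots> = event_prob (S - set us) x"
    unfolding sum_out_append[symmetric] using assms vs parents_obs_subset
    by (intro event_prob_eq_sum_out[symmetric]) auto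
  finally show ?thesis .
qed

end

section \<open>The Markov property\<close>

context causal_model
begin

text \<open>The factor of the ancestral set \<open>N\<close> splits in two: one part sees no
  variables but those in \<open>C \<union> Z\<close>, the other sees none in \<open>C\<close>.
  Summing over \<open>B\<close> affects the first part only, summing over \<open>y\<close> the
  second only.\<close>

theorem d_separated_imp_cond_indep:
  assumes B: "B \<subseteq> V" "B \<inter> Z = {}" and y: "y \<in> V" "y \<notin> Z" and Z: "Z \<subseteq> V"
    and sep: "d_separated G B {y} Z"
  shows "cond_indep (assignments M) (obs_dist M) B {y} Z"
proof -
  have Bn: "B \<subseteq> nodes G" using B by (auto simp: nodes_def)
  have nr: "\<not> reach G B Z y d" for d
    by (rule d_separated_not_reach[OF graph Bn B(2) y(2) sep])
  define N where "N = {v \<in> V. ancestral_to G (B \<union> {y} \<union> Z) v}"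
  define C where "C = {w. w \<notin> Z \<and> (\<exists>d. reach G B Z w d)}"
  define fam where "fam v = insert v (parents_obs G v \<union> parents_unobs G v)" for v
  define N1 where "N1 = {v \<in> N. fam v \<inter> C \<noteq> {}}"
  define N2 where "N2 = N - N1"
  have NV: "N \<subseteq> V" and N12: "N = N1 \<union> N2" "N1 \<inter> N2 = {}" by (auto simp: N_def N1_def N2_def)
  have TN: "B \<union> {y} \<union> Z \<subseteq> N" using B y Z by (auto simp: N_def intro: ancestral_to_self)
  have anc: "parents_obs G w \<subseteq> N" if "w \<in> N" for w
    using that by (auto simp: N_def parents_obs_def intro: ancestral_to_step)
  \<comment> \<open>No family straddles the two sides: once one member of a family is reachable, the
    walk continues to \<open>v\<close> and by \<open>reach_parent\<close> to all its
    parents.\<close>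
  have fam1: "fam v \<subseteq> C \<union> Z" if "v \<in> N1" for v
  proof -
    have "fam v \<inter> C \<noteq> {}" using that by (simp add: N1_def)
    then obtain w d where w: "w \<in> fam v" "w \<notin> Z" "reach G B Z w d" by (auto simp: C_def)
    have v: "ancestral_to G (B \<union> {y} \<union> Z) v" using that by (simp add: N1_def N_def)
    have "\<exists>d'. reach G B Z v d' \<and> (\<not> d' \<longrightarrow> v \<notin> Z)"
    proof (cases "w = v")
      case False
      then have "(w, v) \<in> edges G" using w by (auto simp: fam_def parents_obs_def parents_unobs_def)
      with w have "reach G B Z v True" by (blast intro: reach.fwd)
      then show ?thesis by blast
    qed (use w in blast)
    then obtain d' where d': "reach G B Z v d'" "\<not> d' \<Longrightarrow> v \<notin> Z" by blast
    show ?thesis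
    proof
      fix w' assume "w' \<in> fam v"
      then consider "w' = v" | "(w', v) \<in> edges G"
        by (auto simp: fam_def parents_obs_def parents_unobs_def)
      then show "w' \<in> C \<union> Z"
      proof cases
        case 2
        then have "reach G B Z w' False" using reach_parent[OF d' _ v nr] by blast
        then show ?thesis by (auto simp: C_def)
      qed (use d' in \<open>auto simp: C_def\<close>)
    qed
  qed
  have fam2: "fam v \<inter> C = {}" if "v \<in> N2" for v using that by (auto simp: N2_def N1_def)
  let ?c1 = "c_factor M N1" and ?c2 = "c_factor M N2" and ?S = "sum_out (vals M)"
  have latent: "parents_unobs G v \<inter> parents_unobs G w = {}" if "v \<in> N1" "w \<in> N2" for v w
  proof (rule ccontr)
    assume "\<not> ?thesis"
    then obtain u where u: "u \<in> parents_unobs G v" "u \<in> parents_unobs G w" by blast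
    then have "u \<notin> Z" using Z disjoint parents_unobs_subset by blast
    then have "u \<in> C" using fam1[OF that(1)] u by (auto simp: fam_def)
    then show False using fam2[OF that(2)] u by (auto simp: fam_def)
  qed
  have split: "c_factor M N x = ?c1 x * ?c2 x" if "x \<in> X" for x
    unfolding N12(1) using N12 NV that latent by (intro c_factor_mult) auto
  have ig1: "ignores ?c1 v" if "v \<notin> C \<union> Z" for v
    using fam1 that by (intro ignores_c_factor) (auto simp: fam_def)
  have ig2: "ignores ?c2 v" if "v \<in> C" for v
    using fam2 that by (intro ignores_c_factor) (auto simp: fam_def)
  have prob: "event_prob S x = ?S vs ?c1 x * ?S ws ?c2 x"
    if "S \<subseteq> N" "x \<in> X" "distinct (vs @ ws)" "set (vs @ ws) = N - S" "set vs \<subseteq> C" "set ws \<inter> (C \<union> Z) = {}"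
    for S x vs ws
  proof -
    have "event_prob S x = ?S (vs @ ws) (c_factor M N) x"
      using that by (intro event_prob_eq_sum_out NV anc) auto
    also have "\<dots> = ?S (vs @ ws) (\<lambda>x. ?c1 x * ?c2 x) x"
      using that NV split by (intro sum_out_cong[of _ V]) auto
    also have "\<dots> = ?S vs ?c1 x * ?S ws ?c2 x"
      by (intro sum_out_mult ig1 ig2) (use that in auto)
    finally show ?thesis .
  qed
  have BC: "B \<subseteq> C" using B by (auto simp: C_def intro: reach.start)
  have yC: "y \<notin> C" using nr by (auto simp: C_def)
  have fin: "finite N" using NV finite_V by (rule finite_subset)
  obtain ps where ps: "set ps = (N - (B \<union> {y} \<union> Z)) \<inter> C" "distinct ps"
    using finite_distinct_list[of "(N - (B \<union> {y} \<union> Z)) \<inter> C"] fin by auto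
  obtain qs where qs: "set qs = (N - (B \<union> {y} \<union> Z)) - C" "distinct qs"
    using finite_distinct_list[of "(N - (B \<union> {y} \<union> Z)) - C"] fin by auto
  obtain bs where bs: "set bs = B" "distinct bs"
    using finite_distinct_list[of B] finite_subset[OF B(1) finite_V] by auto
  show ?thesis
    unfolding cond_indep_iff_event_prob
  proof
    fix x assume x: "x \<in> X"
    \<comment> \<open>Two sums of \<open>?c1\<close> and two of \<open>?c2\<close> occur in all, and
      both sides of the identity multiply the same four.\<close>
    have "event_prob (B \<union> {y} \<union> Z) x = ?S ps ?c1 x * ?S qs ?c2 x"
      using x ps qs bs TN by (intro prob) auto
    moreover have "event_prob Z x = ?S (bs @ ps) ?c1 x * ?S (y # qs) ?c2 x"
      using x ps qs bs TN BC yC y B by (intro prob) auto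
    moreover have "event_prob (B \<union> Z) x = ?S ps ?c1 x * ?S (y # qs) ?c2 x"
      using x ps qs bs TN BC yC y B by (intro prob) auto
    moreover have "event_prob ({y} \<union> Z) x = ?S (bs @ ps) ?c1 x * ?S qs ?c2 x"
      using x ps qs bs TN BC yC y B by (intro prob) auto
    ultimately show "event_prob (B \<union> {y} \<union> Z) x * event_prob Z x =
        event_prob (B \<union> Z) x * event_prob ({y} \<union> Z) x"
      by (simp only: mult.commute mult.left_commute mult.assoc)
  qed
qed

text \<open>The identity for \<open>B\<close> is summed over \<open>B - A\<close>; the events on
  \<open>Z\<close> and \<open>{y} \<union> Z\<close> do not involve these variables.\<close>

lemma cond_indep_subset:
  assumes ci: "cond_indep (assignments M) (obs_dist M) B {y} Z"
    and sets: "A \<subseteq> B" "B \<subseteq> V" "B \<inter> Z = {}" "y \<in> V" "y \<notin> B" "Z \<subseteq> V"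
  shows "cond_indep (assignments M) (obs_dist M) A {y} Z"
  unfolding cond_indep_iff_event_prob
proof
  fix x assume x: "x \<in> X"
  obtain us where us: "set us = B - A" "distinct us"
    using finite_distinct_list[of "B - A"] sets finite_V by (auto intro: finite_subset)
  let ?S = "sum_out (vals M) us"
  have "?S (\<lambda>x. event_prob (B \<union> {y} \<union> Z) x * event_prob Z x) x
      = ?S (event_prob (B \<union> {y} \<union> Z)) x * event_prob Z x"
    using us sets by (intro sum_out_mult_right ignores_event_prob) auto
  moreover have "?S (\<lambda>x. event_prob (B \<union> Z) x * event_prob ({y} \<union> Z) x) x
      = ?S (event_prob (B \<union> Z)) x * event_prob ({y} \<union> Z) x"
    using us sets by (intro sum_out_mult_right ignores_event_prob) auto
  moreover have "?S (\<lambda>x. event_prob (B \<union> {y} \<union> Z) x * event_prob Z x) x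
      = ?S (\<lambda>x. event_prob (B \<union> Z) x * event_prob ({y} \<union> Z) x) x"
    using x us sets ci by (intro sum_out_cong[of _ V]) (auto simp: cond_indep_iff_event_prob)
  moreover have "?S (event_prob (B \<union> {y} \<union> Z)) x = event_prob (A \<union> {y} \<union> Z) x"
  proof -
    have "B \<union> {y} \<union> Z - set us = A \<union> {y} \<union> Z" using us sets by auto
    then show ?thesis using sum_out_event_prob[of "B \<union> {y} \<union> Z" us x] x us sets by auto
  qed
  moreover have "?S (event_prob (B \<union> Z)) x = event_prob (A \<union> Z) x"
  proof -
    have "B \<union> Z - set us = A \<union> Z" using us sets by auto
    then show ?thesis using sum_out_event_prob[of "B \<union> Z" us x] x us sets by auto
  qed
  ultimately show "event_prob (A \<union> {y} \<union> Z) x * event_prob Z x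
      = event_prob (A \<union> Z) x * event_prob ({y} \<union> Z) x" by simp
qed

text \<open>With \<open>y\<close> in \<open>B\<close> the identity says that fixing \<open>y\<close>
  besides \<open>Z\<close> loses no mass. A second value of \<open>y\<close> would carry positive
  mass that is lost.\<close>

lemma cond_indep_self_imp_const:
  assumes ci: "cond_indep (assignments M) (obs_dist M) B {y} Z"
    and y: "y \<in> B" "y \<notin> Z" "y \<in> V"
    and positive: "\<And>x. x \<in> X \<Longrightarrow> 0 < c_factor M V x"
    and s: "s \<in> X" and a: "a \<in> vals M y"
  shows "s y = a"
proof (rule ccontr)
  assume ne: "s y \<noteq> a"
  define s' where "s' = s(y := a)"
  have s': "s' \<in> X" using s a y by (simp add: s'_def fun_upd_mem_PiE)
  have pos: "0 < event_prob (B \<union> Z) s"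
    using positive[OF s] c_factor_le_event_prob[OF s] by (rule less_le_trans)
  have "B \<union> {y} \<union> Z = B \<union> Z" using y by auto
  then have "event_prob (B \<union> Z) s * event_prob Z s = event_prob (B \<union> Z) s * event_prob ({y} \<union> Z) s"
    using ci s by (auto simp: cond_indep_iff_event_prob)
  then have eq: "event_prob Z s = event_prob ({y} \<union> Z) s"
    using pos event_prob_finite[OF s, of "B \<union> Z"] by (auto simp: ennreal_mult_cancel_left)
  let ?f = "c_factor M V" and ?F = "fixing X"
  have "event_prob ({y} \<union> Z) s + ?f s' =
      (\<integral>\<^sup>+x. ?f x * indicator (?F ({y} \<union> Z) s) x + ?f x * indicator {s'} x \<partial>count_space UNIV)"
    by (simp add: nn_integral_add event_prob_def nn_integral_count_space_indicator)
  also have "\<dots> \<le> (\<integral>\<^sup>+x. ?f x * indicator (?F Z s) x \<partial>count_space UNIV)"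
    using ne s' y by (intro nn_integral_mono) (auto simp: fixing_def s'_def split: split_indicator)
  also have "\<dots> = event_prob Z s"
    by (simp add: event_prob_def nn_integral_count_space_indicator)
  finally have "event_prob Z s + ?f s' \<le> event_prob Z s + 0" by (simp add: eq)
  moreover have "event_prob Z s \<noteq> \<top>" using event_prob_finite[OF s, of Z] by auto
  ultimately have "?f s' \<le> 0" by (simp add: ennreal_add_left_cancel_le)
  with positive[OF s'] show False by simp
qed

end

section \<open>Identification of the causal effect\<close>

context causal_model
begin

text \<open>Variables outside the parent-closed set \<open>A\<close> have no children in it and are
  summed away. The assignment \<open>s\<close> supplies both the forced value of \<open>t\<close>
  and the value of \<open>y\<close>.\<close>

lemma causal_effect_eq_sum_out:
  assumes A: "A \<subseteq> V" "\<And>w. w \<in> A \<Longrightarrow> parents_obs G w \<subseteq> A" and ty: "t \<in> A" "y \<in> A" "t \<noteq> y"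
    and s: "s \<in> X" and ws: "distinct ws" "set ws = A - {t, y}"
  shows "causal_effect M t (s t) y (s y) = enn2real (sum_out (vals M) ws (c_factor M (A - {t})) s)"
proof -
  let ?do = "do_dist M {t} (\<lambda>_. s t)" and ?F = "fixing X"
  obtain us where us: "set us = V - A" "distinct us"
    using finite_distinct_list[of "V - A"] finite_V by auto
  have do_eq: "ennreal (?do x) = c_factor M (V - {t}) x * indicator {x. x t = s t} x" if "x \<in> X" for x
    using ennreal_integral_eq_c_factor[of "V - {t}" x] that by (auto simp: do_dist_def)
  have nn: "0 \<le> ?do x" for x
    unfolding do_dist_def
    by (intro mult_nonneg_nonneg Bochner_Integration.integral_nonneg) (auto intro!: prod_nonneg)
  have "(\<integral>\<^sup>+x. ennreal (?do x) \<partial>count_space (?F {y} (\<lambda>_. s y)))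
      = (\<integral>\<^sup>+x. c_factor M (V - {t}) x * indicator {x. x t = s t} x \<partial>count_space (?F {y} (\<lambda>_. s y)))"
    by (intro nn_integral_cong do_eq) (simp add: fixing_def)
  also have "\<dots> = (\<integral>\<^sup>+x. c_factor M (V - {t}) x \<partial>count_space (?F {t, y} s))"
    unfolding nn_integral_count_space_indicator[of "?F _ _", simplified]
    by (intro nn_integral_cong) (auto simp: fixing_def split: split_indicator)
  also have "\<dots> = sum_out (vals M) (ws @ us) (c_factor M (V - {t})) s"
    using assms us by (intro nn_integral_fixing_eq_sum_out) auto
  also have "\<dots> = sum_out (vals M) ws (c_factor M (A - {t})) s"
    unfolding sum_out_append
  proof (rule sum_out_cong[of _ V])
    fix x assume "x \<in> X"
    then have "sum_out (vals M) us (c_factor M (V - {t})) x = c_factor M (V - {t} - (V - A)) x"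
      using A ty us by (intro sum_out_c_factor) auto
    moreover have "V - {t} - (V - A) = A - {t}" using A by auto
    ultimately show "sum_out (vals M) us (c_factor M (V - {t})) x = c_factor M (A - {t}) x" by simp
  qed (use assms in auto)
  finally show ?thesis
    unfolding causal_effect_def assignments_def by (simp add: marginal_eq_enn2real nn)
qed

end

section \<open>Two models with the same graph and observational distribution\<close>

locale equivalent_models = causal_model M + other: causal_model M'
  for M :: "('w, 'a, 'l) smcm" and M' :: "('w, 'a, 'k) smcm" +
  assumes graph_eq: "graph M' = graph M"
    and vals_eq: "\<And>v. v \<in> observed (graph M) \<Longrightarrow> vals M' v = vals M v"
    and obs_eq: "\<And>x. x \<in> X \<Longrightarrow> c_factor M' V x = c_factor M V x"
    and positive: "\<And>x. x \<in> X \<Longrightarrow> 0 < c_factor M V x"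
begin

lemma X_eq: "PiE V (vals M') = X"
  using vals_eq by (intro PiE_cong)

text \<open>Summing out \<open>V - N\<close> gives both sides from the observational distribution,
  which the models share.\<close>

lemma c_factor_ancestral_eq:
  assumes "N \<subseteq> V" "\<And>w. w \<in> N \<Longrightarrow> parents_obs G w \<subseteq> N" "x \<in> X"
  shows "c_factor M' N x = c_factor M N x"
proof -
  obtain vs where vs: "set vs = V - N" "distinct vs"
    using finite_distinct_list[of "V - N"] finite_V by auto
  have np: "parents_obs G w \<inter> (V - N) = {}" if "w \<in> V - (V - N)" for w
    using that assms(2)[of w] by blast
  have VN: "V - (V - N) = N" using assms(1) by blast
  have "c_factor M N x = sum_out (vals M) vs (c_factor M V) x"
    using sum_out_c_factor[OF _ _ np vs(2,1) assms(3)] by (simp add: VN)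
  also have "\<dots> = sum_out (vals M') vs (c_factor M' V) x"
    using assms vs vals_eq obs_eq by (intro sum_out_cong[of _ V]) auto
  also have "\<dots> = c_factor M' N x"
    using other.sum_out_c_factor[of "V - N" V vs x] np vs assms(3) unfolding graph_eq X_eq
    by (simp add: VN)
  finally show ?thesis ..
qed

lemma c_factor_pos: "C \<subseteq> V \<Longrightarrow> x \<in> X \<Longrightarrow> 0 < c_factor M C x"
  using positive c_factor_antimono[OF _ finite_V] by (meson less_le_trans)

text \<open>Deleting a sink \<open>v\<close> keeps \<open>S \<union> K\<close> closed under parents,
  so the induction hypothesis settles the factor not containing \<open>v\<close>. The product of the
  factors is settled by \<open>c_factor_ancestral_eq\<close>, and cancellation gives the other
  one.\<close>

lemma c_factor_eq:
  assumes "S \<union> K \<subseteq> V" "S \<inter> K = {}" "\<And>w. w \<in> S \<union> K \<Longrightarrow> parents_obs G w \<subseteq> S \<union> K"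
    and "\<And>v w. v \<in> S \<Longrightarrow> w \<in> K \<Longrightarrow> parents_unobs G v \<inter> parents_unobs G w = {}"
    and x: "x \<in> X"
  shows "c_factor M' S x = c_factor M S x \<and> c_factor M' K x = c_factor M K x"
proof -
  have "finite (S \<union> K)" using assms(1) finite_V by (rule finite_subset)
  then show ?thesis using assms(1-4)
  proof (induction "S \<union> K" arbitrary: S K rule: finite_psubset_induct)
    case (psubset S K)
    note prems = psubset(3-6)
    show ?case
    proof (cases "S \<union> K = {}")
      case True
      then show ?thesis using c_factor_ancestral_eq[of "{}"] x by simp
    next
      case False
      then obtain v where v: "v \<in> S \<union> K" "\<And>w. w \<in> S \<union> K \<Longrightarrow> v \<notin> parents_obs G w"
        using obtain_sink[OF prems(1)] by blast
      have IH: "c_factor M' (S - {v}) x = c_factor M (S - {v}) x \<and>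
        c_factor M' (K - {v}) x = c_factor M (K - {v}) x"
      proof (rule psubset(2))
        show "S - {v} \<union> (K - {v}) \<subset> S \<union> K" using v(1) by blast
        show "S - {v} \<union> (K - {v}) \<subseteq> V" using prems(1) by blast
        show "(S - {v}) \<inter> (K - {v}) = {}" using prems(2) by blast
        show "parents_obs G w \<subseteq> S - {v} \<union> (K - {v})" if "w \<in> S - {v} \<union> (K - {v})" for w
          using that v(2)[of w] prems(3)[of w] by blast
        show "parents_unobs G w \<inter> parents_unobs G w' = {}" if "w \<in> S - {v}" "w' \<in> K - {v}" for w w'
          using that prems(4)[of w w'] by blast
      qed
      have SK: "S \<subseteq> V" "K \<subseteq> V" using prems(1) by auto
      have "c_factor M S x * c_factor M K x = c_factor M (S \<union> K) x"
        by (rule c_factor_mult[OF SK prems(2) x prems(4), symmetric])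
      also have "\<dots> = c_factor M' (S \<union> K) x"
        by (rule c_factor_ancestral_eq[OF prems(1,3) x, symmetric])
      also have "\<dots> = c_factor M' S x * c_factor M' K x"
        using other.c_factor_mult[of S K x] SK prems(2,4) x unfolding graph_eq X_eq by blast
      finally have eq: "c_factor M S x * c_factor M K x = c_factor M' S x * c_factor M' K x" .
      have fin: "c_factor M C x \<noteq> \<top>" for C
        by (rule neq_top_trans[OF ennreal_one_neq_top c_factor_le_1])
      have pos: "c_factor M S x \<noteq> 0" "c_factor M K x \<noteq> 0"
        using c_factor_pos[OF SK(1) x] c_factor_pos[OF SK(2) x] by auto
      consider "v \<in> S" "v \<notin> K" | "v \<in> K" "v \<notin> S" using v(1) prems(2) by blast
      then show ?thesis
      proof cases
        case 1
        then have "c_factor M' K x = c_factor M K x" using IH by simp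
        with eq have "c_factor M K x * c_factor M S x = c_factor M K x * c_factor M' S x"
          by (simp add: mult.commute)
        with \<open>c_factor M' K x = c_factor M K x\<close> fin pos show ?thesis
          by (simp add: ennreal_mult_cancel_left)
      next
        case 2
        then have "c_factor M' S x = c_factor M S x" using IH by simp
        with eq fin pos show ?thesis by (simp add: ennreal_mult_cancel_left)
      qed
    qed
  qed
qed

lemma causal_effect_eq:
  assumes sep: "d_separated G b {y} Z" and b: "b = children G t"
    and t: "t \<in> V" "t \<in> Z" and y: "y \<in> V" "y \<notin> Z" and Z: "Z \<subseteq> V" "b \<inter> Z = {}"
    and desc: "descendant G t y" and conf: "bidirected G t y"
    and s: "s \<in> X"
  shows "causal_effect M' t (s t) y (s y) = causal_effect M t (s t) y (s y)"
proof -
  have bn: "b \<subseteq> nodes G" using edges_subset by (auto simp: b children_def nodes_def)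
  have nr: "\<not> reach G b Z y d" for d
    by (rule d_separated_not_reach[OF graph bn Z(2) y(2) sep])
  have ty: "t \<noteq> y" using t y by auto
  have tb: "t \<notin> b" using acyclic by (auto simp: b children_def acyclic_def)
  define A where "A = {v \<in> V. ancestral_to G {y} v}"
  \<comment> \<open>A child of \<open>t\<close> lies in \<open>b\<close>, outside \<open>Z\<close>,
    so \<open>t\<close> is always reached backwards from it with flag \<open>False\<close>. Asking
    for an arrowhead is what can keep \<open>t\<close> out of \<open>K\<close>.\<close>
  define K where "K = {v \<in> A. v \<in> b \<or> reach G b Z v True}"
  define S where "S = A - K"
  have A: "A \<subseteq> V" "A = S \<union> K" "S \<inter> K = {}" by (auto simp: A_def S_def K_def)
  have ancA: "parents_obs G w \<subseteq> A" if "w \<in> A" for w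
    using that by (auto simp: A_def parents_obs_def intro: ancestral_to_step)
  have tyA: "t \<in> A" "y \<in> A"
    using t y desc by (auto simp: A_def ancestral_to_def descendant_def intro: trancl_into_rtrancl)
  have up: "reach G b Z u False" if "v \<in> A" "reach G b Z v d" "\<not> d \<Longrightarrow> v \<notin> Z" "(u, v) \<in> edges G" for u v d
    using reach_parent[OF that(2-4) _ nr] that(1) by (auto simp: A_def ancestral_to_def)
  have unobs: "u \<notin> Z" if "u \<in> parents_unobs G v" for u v
    using that Z disjoint parents_unobs_subset by blast
  \<comment> \<open>Reached along an arrowhead, \<open>t\<close> in \<open>Z\<close> is an open
    collider, and the walk would go on through the confounder to \<open>y\<close>.\<close>
  have "t \<notin> K"
  proof
    assume "t \<in> K"
    then have "reach G b Z t True" using tb by (simp add: K_def)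
    obtain u where u: "u \<in> parents_unobs G t" "u \<in> parents_unobs G y"
      using conf by (auto simp: bidirected_def)
    then have "reach G b Z u False"
      using up[OF tyA(1) \<open>reach G b Z t True\<close>] by (simp add: parents_unobs_def)
    moreover have "(u, y) \<in> edges G" using u(2) by (simp add: parents_unobs_def)
    ultimately have "reach G b Z y True" using unobs[OF u(1)] by (blast intro: reach.fwd)
    with nr show False by blast
  qed
  then have tS: "t \<in> S" using tyA by (simp add: S_def)
  have latent: "parents_unobs G v \<inter> parents_unobs G w = {}" if "v \<in> S" "w \<in> K" for v w
  proof (rule ccontr)
    assume "\<not> ?thesis"
    then obtain u where u: "u \<in> parents_unobs G v" "u \<in> parents_unobs G w" by blast
    have "\<exists>d. reach G b Z w d \<and> (\<not> d \<longrightarrow> w \<notin> Z)"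
      using that(2) Z(2) by (auto simp: K_def intro: reach.start)
    then obtain d where d: "reach G b Z w d" "\<not> d \<Longrightarrow> w \<notin> Z" by blast
    have uv: "(u, v) \<in> edges G" "(u, w) \<in> edges G" using u by (auto simp: parents_unobs_def)
    have "w \<in> A" using that(2) by (simp add: K_def)
    then have "reach G b Z u False" using d uv(2) by (rule up)
    then have "reach G b Z v True" using unobs[OF u(1)] uv(1) by (rule reach.fwd)
    then show False using that by (simp add: S_def K_def)
  qed
  have child: "t \<notin> parents_obs G w" if "w \<in> S" for w
    using that by (auto simp: S_def K_def b children_def parents_obs_def)
  have eqA: "c_factor M' (A - {t}) x = c_factor M (A - {t}) x" if x: "x \<in> X" for x
  proof -
    have SV: "S \<subseteq> V" "K \<subseteq> V" using A by auto
    have eq: "c_factor M' S x' = c_factor M S x'" "c_factor M' K x' = c_factor M K x'" if "x' \<in> X" for x'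
      using c_factor_eq[of S K, OF _ A(3) _ latent that] A(1) ancA unfolding A(2) by blast+
    \<comment> \<open>The factor of \<open>S\<close> agrees in both models at every value of
      \<open>t\<close>, so summing over \<open>t\<close> preserves the agreement. The factor of
      \<open>K\<close>, which holds the children of \<open>t\<close>, is kept at the given value of
      \<open>t\<close>.\<close>
    have "c_factor M (S - {t}) x = (\<integral>\<^sup>+a. c_factor M S (x(t := a)) \<partial>count_space (vals M t))"
      by (rule sum_c_factor[OF x SV(1) tS child, symmetric])
    also have "\<dots> = (\<integral>\<^sup>+a. c_factor M' S (x(t := a)) \<partial>count_space (vals M t))"
      using x t by (intro nn_integral_cong eq(1)[symmetric] fun_upd_mem_PiE) simp_all
    also have "\<dots> = c_factor M' (S - {t}) x"
      using other.sum_c_factor[of x S t] x SV tS child vals_eq[OF t(1)] unfolding graph_eq X_eq by simp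
    finally have eqS: "c_factor M' (S - {t}) x = c_factor M (S - {t}) x" ..
    have At: "A - {t} = (S - {t}) \<union> K" using A \<open>t \<notin> K\<close> by auto
    have St: "S - {t} \<subseteq> V" "(S - {t}) \<inter> K = {}" using SV A(3) by auto
    have lt: "parents_unobs G v \<inter> parents_unobs G w = {}" if "v \<in> S - {t}" "w \<in> K" for v w
      using latent that by blast
    have "c_factor M (A - {t}) x = c_factor M (S - {t}) x * c_factor M K x"
      unfolding At by (rule c_factor_mult[OF St(1) SV(2) St(2) x lt])
    moreover have "c_factor M' (A - {t}) x = c_factor M' (S - {t}) x * c_factor M' K x"
      unfolding At using other.c_factor_mult[of "S - {t}" K x] St SV x lt unfolding graph_eq X_eq by blast
    ultimately show ?thesis using eqS eq x by simp
  qed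
  obtain ws where ws: "set ws = A - {t, y}" "distinct ws"
    using finite_distinct_list[of "A - {t, y}"] A finite_V by (auto intro: finite_subset)
  have "causal_effect M t (s t) y (s y) = enn2real (sum_out (vals M) ws (c_factor M (A - {t})) s)"
    by (rule causal_effect_eq_sum_out[OF A(1) ancA tyA ty s ws(2,1)])
  also have "sum_out (vals M) ws (c_factor M (A - {t})) s = sum_out (vals M') ws (c_factor M' (A - {t})) s"
    using s ws A vals_eq eqA by (intro sum_out_cong[of _ V]) auto
  also have "enn2real \<dots> = causal_effect M' t (s t) y (s y)"
    using other.causal_effect_eq_sum_out[of A t y s ws] A(1) ancA tyA ty s ws
    unfolding graph_eq X_eq by simp
  finally show ?thesis ..
qed

end

text \<open>The walk from \<open>t\<close> up to the common latent parent and down to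
  \<open>y\<close> has no collider, so the empty set does not block it.\<close>

lemma bidirected_not_d_separated:
  assumes "is_causal_graph G" "t \<in> nodes G" "bidirected G t y"
  shows "\<not> d_separated G {t} {y} {}"
proof
  assume sep: "d_separated G {t} {y} {}"
  obtain u where u: "(u, t) \<in> edges G" "(u, y) \<in> edges G"
    using assms(3) by (auto simp: bidirected_def parents_unobs_def)
  have "reach G {t} {} y True"
    using u by (blast intro: reach.intros)
  with d_separated_not_reach[OF assms(1) _ _ _ sep] assms(2) show False by auto
qed

text \<open>The second conjunct renders the words "without the knowledge of the graph": given
  \<open>b\<close>, the separation hypothesis is equivalent to a statement about the observational
  distribution alone. Positivity serves to cancel factors and to exclude \<open>y\<close> from
  \<open>b\<close>.\<close>

theorem theorem1:
  fixes M :: "('w, 'a, 'l) smcm" and t y :: 'w and b :: "'w set"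
  assumes model: "is_smcm M"
    and faithful: "faithful M"
    and positive: "\<forall>x \<in> assignments M. obs_dist M x > 0"
    and t: "t \<in> observed (graph M)"
    and y: "y \<in> observed (graph M)"
    and desc: "descendant (graph M) t y"
    and confounded: "bidirected (graph M) t y"
    and b: "b = children (graph M) t"
  shows
    "((\<exists>z \<subseteq> observed (graph M) - ({t} \<union> b \<union> {y}). d_separated (graph M) b {y} ({t} \<union> z))
        \<longrightarrow> (\<forall>\<tau> \<in> vals M t. identifiable TYPE('k) M t \<tau> y)) \<and>
     (\<forall>z \<subseteq> observed (graph M) - ({t} \<union> b \<union> {y}).
        d_separated (graph M) b {y} ({t} \<union> z) \<longleftrightarrow>
        cond_indep (assignments M) (obs_dist M) b {y} ({t} \<union> z))"
proof -
  interpret causal_model M using model by unfold_locales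
  have pos: "0 < c_factor M V x" if "x \<in> X" for x
    using positive obs_dist_eq_c_factor[OF that] that by (auto simp: assignments_def simp flip: ennreal_less_zero_iff)
  have ty: "t \<noteq> y" using desc acyclic by (auto simp: descendant_def acyclic_def)
  have tb: "t \<notin> b" using acyclic by (auto simp: b children_def acyclic_def)
  have bV: "b \<subseteq> V" using edges_subset by (auto simp: b children_def)
  have not_sep: "\<not> d_separated G {t} {y} {}"
    using graph t confounded by (intro bidirected_not_d_separated) (auto simp: nodes_def)
  have identified: "identifiable TYPE('k) M t \<tau> y"
    if z: "z \<subseteq> V - ({t} \<union> b \<union> {y})" and sep: "d_separated G b {y} ({t} \<union> z)" and \<tau>: "\<tau> \<in> vals M t"
    for z \<tau>
    unfolding identifiable_def
  proof (intro allI impI ballI)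
    fix M' :: "('w, 'a, 'k) smcm" and \<eta>
    assume M': "is_smcm M' \<and> graph M' = graph M \<and> (\<forall>v\<in>observed (graph M). vals M' v = vals M v) \<and>
      (\<forall>x\<in>assignments M. obs_dist M' x = obs_dist M x)" and \<eta>: "\<eta> \<in> vals M y"
    have assignments_eq: "assignments M' = assignments M"
      using M' by (auto simp: assignments_def intro!: PiE_cong)
    interpret other: causal_model M' using M' by unfold_locales simp
    interpret equivalent_models M M'
    proof unfold_locales
      show "c_factor M' V x = c_factor M V x" if "x \<in> X" for x
        using that M' assignments_eq obs_dist_eq_c_factor[OF that] other.obs_dist_eq_c_factor[of x]
        by (auto simp: assignments_def)
    qed (use M' pos in auto)
    show "causal_effect M' t \<tau> y \<eta> = causal_effect M t \<tau> y \<eta>"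
    \<comment> \<open>Without assignments both effects are empty sums. Otherwise any assignment can
      be changed to take the values \<open>\<tau>\<close> at \<open>t\<close> and
      \<open>\<eta>\<close> at \<open>y\<close>.\<close>
    proof (cases "X = {}")
      case True
      then have "assignments M = {}" by (simp only: assignments_def)
      then show ?thesis by (simp add: causal_effect_def marginal_def assignments_eq)
    next
      case False
      then obtain x where "x \<in> X" by blast
      then have s: "x(t := \<tau>, y := \<eta>) \<in> X" using t y \<tau> \<eta> by (intro fun_upd_mem_PiE)
      show ?thesis
        using causal_effect_eq[OF sep b t _ y _ _ _ desc confounded s] z ty tb t by auto
    qed
  qed
  have "d_separated G b {y} ({t} \<union> z) \<longleftrightarrow> cond_indep (assignments M) (obs_dist M) b {y} ({t} \<union> z)"
    if z: "z \<subseteq> V - ({t} \<union> b \<union> {y})" for z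
  proof
    assume "d_separated G b {y} ({t} \<union> z)"
    then show "cond_indep (assignments M) (obs_dist M) b {y} ({t} \<union> z)"
      using z t y ty tb bV by (intro d_separated_imp_cond_indep) auto
  next
    assume ci: "cond_indep (assignments M) (obs_dist M) b {y} ({t} \<union> z)"
    have "y \<notin> b"
    proof
      assume "y \<in> b"
      have const: "s y = x y" if "s \<in> X" "x \<in> X" for s x
        using cond_indep_self_imp_const[OF ci \<open>y \<in> b\<close> _ y pos that(1)] that(2) y z ty by (auto simp: PiE_mem)
      have "cond_indep (assignments M) (obs_dist M) {t} {y} {}"
      proof -
        \<comment> \<open>Since \<open>y\<close> is constant on \<open>X\<close>, fixing its value
          does not shrink any event, and the independence identity becomes trivial.\<close>
        have "{x \<in> X. x t = s t \<and> x y = s y} = {x \<in> X. x t = s t}" "{x \<in> X. x y = s y} = X"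
          if "s \<in> X" for s
          using const that by auto
        then show ?thesis
          by (simp add: cond_indep_def assignments_def marginal_def conj_commute)
      qed
      then have "d_separated G {t} {y} {}"
        using faithful t y ty by (auto simp: faithful_def)
      with not_sep show False ..
    qed
    \<comment> \<open>Faithfulness speaks of pairs of distinct single variables, so the independence
      is first restricted to one child \<open>b'\<close>.\<close>
    have "d_separated G {b'} {y} ({t} \<union> z)" if "b' \<in> b" for b'
    proof -
      have "cond_indep (assignments M) (obs_dist M) {b'} {y} ({t} \<union> z)"
        using cond_indep_subset[OF ci, of "{b'}"] that z t y tb bV \<open>y \<notin> b\<close> by auto
      moreover have "{t} \<union> z \<subseteq> V - {b', y}" using z t ty tb that by auto
      ultimately show ?thesis
        using faithful that bV y \<open>y \<notin> b\<close> unfolding faithful_def by (metis subsetD)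
    qed
    then show "d_separated G b {y} ({t} \<union> z)" by (auto simp: d_separated_def)
  qed
  with identified show ?thesis by blast
qed

end
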